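(* Let $p\colon E\to B$ be a fibration, and let $\alpha,\beta,\gamma\in H^*(B)$ be cohomology classes. If the Massey product $\langle\alpha,\beta,\gamma\rangle$ is defined and non-zero, then $$\mathrm{genus}(p)>\mathrm{wgt}_p(\beta)+\min\{\mathrm{wgt}_p(\alpha),\mathrm{wgt}_p(\gamma)\}.$$
   Context: All spaces are assumed to be path-connected and of finite type. $H^*(-)$ denotes singular cohomology with coefficients in an arbitrary commutative ring $R$ with unit. Schwarz genus: for a fibration $p\colon E\to B$, $\mathrm{genus}(p)$ is the minimum $k$ such that $B$ can be covered by open subsets $U_1,\ldots,U_k$, on each of which $p$ admits a continuous local section (a map $s_i\colon U_i\to E$ with $p\circ s_i$ the identity map on $U_i$). Weight: for a non-zero class $u\in H^*(B)$, the weight of $u$ with respect to $p$ is $$\mathrm{wgt}_p(u)=\sup\{k\mid f^*(u)=0\text{ for all maps }f\colon A\to B\text{ with }\mathrm{genus}(f^*p)\leq k\},$$ where $f^*p$ is the pull-back fibration of $p$ along $f$. Here $k$ ranges over positive integers and the supremum of the empty set is $0$. Massey triple product: let $C^*(B)$ be the singular cochain complex of $B$ with coefficients in $R$, with cochain multiplication $\bullet$ and differential $d$ of degree $+1$ satisfying $d(a\bullet b)=da\bullet b+(-1)^{|a|}a\bullet db$. Given $\alpha,\beta,\gamma\in H^*(B)$ of dimensions $p',q',r'$, the Massey product $\langle\alpha,\beta,\gamma\rangle$ is defined if $\alpha\beta=0=\beta\gamma$. Choosing cocycles $a,b,c$ representing $\alpha,\beta,\gamma$ respectively, it is the subset $$\langle\alpha,\beta,\gamma\rangle=\{[a\bullet\lambda+(-1)^{p'+1}\mu\bullet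 c]\mid \mu\in C^{p'+q'-1}(B),\ \lambda\in C^{q'+r'-1}(B),\ d\mu=a\bullet b,\ d\lambda=b\bullet c\}\subseteq H^{p'+q'+r'-1}(B)$$ (the set of all cohomology classes arising in this way). It is called non-zero if $0\notin\langle\alpha,\beta,\gamma\rangle$. *)

theory Defs
  imports "HOL-Analysis.Analysis" "HOL-Homology.Homology" "HOL-Library.Extended_Nat"
begin

section \<open>Singular cohomology with coefficients in a commutative ring\<close>

type_synonym ('a, 'r) cochain = "((nat \<Rightarrow> real) \<Rightarrow> 'a) \<Rightarrow> 'r"

text \<open>
  Degrees are integers, as in \<open>HOL-Homology\<close>: the cochain module is zero in negative degrees.
  A cochain is a function on singular simplices, extended by zero to all other functions.
\<close>

definition cochains :: "'a topology \<Rightarrow> int \<Rightarrow> ('a, 'r::comm_ring_1) cochain set" where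
  "cochains X n = {c. \<forall>\<sigma>. c \<sigma> \<noteq> 0 \<longrightarrow> 0 \<le> n \<and> singular_simplex (nat n) X \<sigma>}"

definition coboundary :: "'a topology \<Rightarrow> int \<Rightarrow> ('a, 'r::comm_ring_1) cochain \<Rightarrow> ('a, 'r) cochain" where
  "coboundary X n c = (\<lambda>\<sigma>. if 0 \<le> n \<and> singular_simplex (nat (n + 1)) X \<sigma>
     then \<Sum>k\<le>nat (n + 1). (- 1) ^ k * c (singular_face (nat (n + 1)) k \<sigma>) else 0)"

definition cocycles :: "'a topology \<Rightarrow> int \<Rightarrow> ('a, 'r::comm_ring_1) cochain set" where
  "cocycles X n = {c \<in> cochains X n. coboundary X n c = (\<lambda>_. 0)}"

text \<open>The coset of a cocycle modulo coboundaries.\<close>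

definition cohomology_class ::
    "'a topology \<Rightarrow> int \<Rightarrow> ('a, 'r::comm_ring_1) cochain \<Rightarrow> ('a, 'r) cochain set" where
  "cohomology_class X n c = {\<lambda>\<sigma>. c \<sigma> + coboundary X (n - 1) b \<sigma> | b. b \<in> cochains X (n - 1)}"

definition cohomology :: "'a topology \<Rightarrow> int \<Rightarrow> ('a, 'r::comm_ring_1) cochain set set" where
  "cohomology X n = cohomology_class X n ` cocycles X n"

definition cohomology_zero :: "'a topology \<Rightarrow> int \<Rightarrow> ('a, 'r::comm_ring_1) cochain set" where
  "cohomology_zero X n = cohomology_class X n (\<lambda>_. 0)"

definition pullback_cochain ::
    "'a topology \<Rightarrow> int \<Rightarrow> ('a \<Rightarrow> 'b) \<Rightarrow> ('b, 'r::comm_ring_1) cochain \<Rightarrow> ('a, 'r) cochain" where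
  "pullback_cochain A n f c =
     (\<lambda>\<sigma>. if singular_simplex (nat n) A \<sigma> then c (simplex_map (nat n) f \<sigma>) else 0)"

text \<open>All the cosets in the unions below coincide, so this is the induced operation on classes.\<close>

definition pullback_class ::
    "'a topology \<Rightarrow> int \<Rightarrow> ('a \<Rightarrow> 'b) \<Rightarrow> ('b, 'r::comm_ring_1) cochain set \<Rightarrow> ('a, 'r) cochain set" where
  "pullback_class A n f u = (\<Union>c\<in>u. cohomology_class A n (pullback_cochain A n f c))"

text \<open>
  The front face is a plain restriction because \<^term>\<open>standard_simplex p\<close> is the set of points of
  \<^term>\<open>standard_simplex (p + q)\<close> whose coordinates beyond \<open>p\<close> vanish.
\<close>

definition front_face :: "nat \<Rightarrow> ((nat \<Rightarrow> real) \<Rightarrow> 'a) \<Rightarrow> ((nat \<Rightarrow> real) \<Rightarrow> 'a)" where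
  "front_face p \<sigma> = restrict \<sigma> (standard_simplex p)"

definition back_face :: "nat \<Rightarrow> nat \<Rightarrow> ((nat \<Rightarrow> real) \<Rightarrow> 'a) \<Rightarrow> ((nat \<Rightarrow> real) \<Rightarrow> 'a)" where
  "back_face p q \<sigma> = restrict (\<lambda>t. \<sigma> (\<lambda>i. if i < p then 0 else t (i - p))) (standard_simplex q)"

definition cup :: "'a topology \<Rightarrow> int \<Rightarrow> int \<Rightarrow>
    ('a, 'r::comm_ring_1) cochain \<Rightarrow> ('a, 'r) cochain \<Rightarrow> ('a, 'r) cochain" where
  "cup X m n a b = (\<lambda>\<sigma>. if 0 \<le> m \<and> 0 \<le> n \<and> singular_simplex (nat (m + n)) X \<sigma>
     then a (front_face (nat m) \<sigma>) * b (back_face (nat m) (nat n) \<sigma>) else 0)"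

definition cup_class :: "'a topology \<Rightarrow> int \<Rightarrow> int \<Rightarrow>
    ('a, 'r::comm_ring_1) cochain set \<Rightarrow> ('a, 'r) cochain set \<Rightarrow> ('a, 'r) cochain set" where
  "cup_class X m n \<alpha> \<beta> = (\<Union>a\<in>\<alpha>. \<Union>b\<in>\<beta>. cohomology_class X (m + n) (cup X m n a b))"


section \<open>Massey triple products\<close>

definition massey_defined :: "'a topology \<Rightarrow> nat \<Rightarrow> nat \<Rightarrow> nat \<Rightarrow> ('a, 'r::comm_ring_1) cochain set \<Rightarrow>
    ('a, 'r) cochain set \<Rightarrow> ('a, 'r) cochain set \<Rightarrow> bool" where
  "massey_defined X i j k \<alpha> \<beta> \<gamma> \<longleftrightarrow>
     cup_class X i j \<alpha> \<beta> = cohomology_zero X (i + j) \<and>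
     cup_class X j k \<beta> \<gamma> = cohomology_zero X (j + k)"

definition massey_cocycles :: "'a topology \<Rightarrow> nat \<Rightarrow> nat \<Rightarrow> nat \<Rightarrow> ('a, 'r::comm_ring_1) cochain \<Rightarrow>
    ('a, 'r) cochain \<Rightarrow> ('a, 'r) cochain \<Rightarrow> ('a, 'r) cochain set set" where
  "massey_cocycles X i j k a b c =
     {cohomology_class X (int i + int j + int k - 1)
        (\<lambda>\<sigma>. cup X i (int j + int k - 1) a l \<sigma> + (- 1) ^ (i + 1) * cup X (int i + int j - 1) k m c \<sigma>)
      | m l. m \<in> cochains X (int i + int j - 1) \<and> l \<in> cochains X (int j + int k - 1) \<and>
             coboundary X (int i + int j - 1) m = cup X i j a b \<and>
             coboundary X (int j + int k - 1) l = cup X j k b c}"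

text \<open>The set does not depend on the chosen representatives.\<close>

definition massey_product :: "'a topology \<Rightarrow> nat \<Rightarrow> nat \<Rightarrow> nat \<Rightarrow> ('a, 'r::comm_ring_1) cochain set \<Rightarrow>
    ('a, 'r) cochain set \<Rightarrow> ('a, 'r) cochain set \<Rightarrow> ('a, 'r) cochain set set" where
  "massey_product X i j k \<alpha> \<beta> \<gamma> =
     massey_cocycles X i j k (SOME a. a \<in> \<alpha>) (SOME b. b \<in> \<beta>) (SOME c. c \<in> \<gamma>)"

definition massey_nonzero :: "'a topology \<Rightarrow> nat \<Rightarrow> nat \<Rightarrow> nat \<Rightarrow> ('a, 'r::comm_ring_1) cochain set \<Rightarrow>
    ('a, 'r) cochain set \<Rightarrow> ('a, 'r) cochain set \<Rightarrow> bool" where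
  "massey_nonzero X i j k \<alpha> \<beta> \<gamma> \<longleftrightarrow>
     cohomology_zero X (int i + int j + int k - 1) \<notin> massey_product X i j k \<alpha> \<beta> \<gamma>"


section \<open>Spaces of finite type\<close>

text \<open>Every integral homology group is finitely generated.\<close>

definition finite_type :: "'a topology \<Rightarrow> bool" where
  "finite_type X \<longleftrightarrow> (\<forall>n. \<exists>S. finite S \<and> S \<subseteq> carrier (homology_group n X) \<and>
     generate (homology_group n X) S = carrier (homology_group n X))"


section \<open>Fibrations\<close>

definition homotopy_lifting ::
    "'y topology \<Rightarrow> 'e topology \<Rightarrow> 'b topology \<Rightarrow> ('e \<Rightarrow> 'b) \<Rightarrow> bool" where
  "homotopy_lifting Y E B p \<longleftrightarrow>
     (\<forall>f H. continuous_map Y E f \<and> continuous_map (prod_topology (top_of_set {0..1::real}) Y) B H \<and>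
        (\<forall>y\<in>topspace Y. H (0, y) = p (f y)) \<longrightarrow>
        (\<exists>G. continuous_map (prod_topology (top_of_set {0..1}) Y) E G \<and>
           (\<forall>y\<in>topspace Y. G (0, y) = f y) \<and>
           (\<forall>t\<in>{0..1}. \<forall>y\<in>topspace Y. p (G (t, y)) = H (t, y))))"

text \<open>
  A Hurewicz fibration.  A definition cannot quantify over the type of points of the test space
  \<open>Y\<close>, so a type is fixed that is large enough for the general case to follow; see
  \<open>fibration_homotopy_lifting\<close> below.
\<close>

definition fibration :: "'e topology \<Rightarrow> 'b topology \<Rightarrow> ('e \<Rightarrow> 'b) \<Rightarrow> bool" where
  "fibration E B p \<longleftrightarrow> continuous_map E B p \<and>
     (\<forall>Y :: ('e \<times> (real \<Rightarrow> 'b)) topology. homotopy_lifting Y E B p)"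

text \<open>The total space of the pull-back along \<open>f\<close>; its projection to \<open>A\<close> is \<^term>\<open>fst\<close>.\<close>

definition pullback_space ::
    "'a topology \<Rightarrow> 'e topology \<Rightarrow> ('a \<Rightarrow> 'b) \<Rightarrow> ('e \<Rightarrow> 'b) \<Rightarrow> ('a \<times> 'e) topology" where
  "pullback_space A E f p = subtopology (prod_topology A E) {(a, e). f a = p e}"


section \<open>Schwarz genus and weight\<close>

definition genus_le :: "'e topology \<Rightarrow> 'b topology \<Rightarrow> ('e \<Rightarrow> 'b) \<Rightarrow> nat \<Rightarrow> bool" where
  "genus_le E B p k \<longleftrightarrow>
     (\<exists>U :: nat \<Rightarrow> 'b set. (\<Union>i<k. U i) = topspace B \<and>
        (\<forall>i<k. openin B (U i) \<and>
           (\<exists>s. continuous_map (subtopology B (U i)) E s \<and> (\<forall>x\<in>U i. p (s x) = x))))"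

text \<open>The genus is \<open>\<infinity>\<close> if there is no such finite cover.\<close>

definition genus :: "'e topology \<Rightarrow> 'b topology \<Rightarrow> ('e \<Rightarrow> 'b) \<Rightarrow> enat" where
  "genus E B p = Inf {enat k | k. genus_le E B p k}"

text \<open>
  The weight of a class of degree \<open>n\<close>.  As for fibrations, the type of points of the test space
  \<open>A\<close> has to be fixed; \<open>le_weight_iff\<close> and \<open>le_weightD\<close> below show that the chosen
  type tests against all spaces.  No connectedness or finiteness is imposed on \<open>A\<close>, which may in
  particular be any open subspace of \<open>B\<close>.
\<close>

definition weight :: "'e topology \<Rightarrow> 'b topology \<Rightarrow> ('e \<Rightarrow> 'b) \<Rightarrow> int \<Rightarrow>
    ('b, 'r::comm_ring_1) cochain set \<Rightarrow> enat" where
  "weight E B p n u = Sup {enat k | k. 1 \<le> k \<and>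
     (\<forall>(A :: ('b \<times> (nat \<Rightarrow> 'e option)) topology) f.
        continuous_map A B f \<and> genus (pullback_space A E f p) A fst \<le> enat k \<longrightarrow>
        pullback_class A n f u = cohomology_zero A n)}"


section \<open>The test spaces may be of any type\<close>

lemma quotient_topology_exists:
  fixes X :: "'a topology" and f :: "'a \<Rightarrow> 'd"
  obtains Q where "quotient_map X Q f"
proof -
  define P where "P = (\<lambda>U. U \<subseteq> f ` topspace X \<and> openin X {x \<in> topspace X. f x \<in> U})"
  have "istopology P"
    unfolding istopology_def
  proof (intro conjI allI impI)
    fix S T assume "P S" "P T"
    then have "openin X ({x \<in> topspace X. f x \<in> S} \<inter> {x \<in> topspace X. f x \<in> T})"
      unfolding P_def by blast
    also have "{x \<in> topspace X. f x \<in> S} \<inter> {x \<in> topspace X. f x \<in> T} = {x \<in> topspace X. f x \<in> S \<inter> T}"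
      by auto
    finally show "P (S \<inter> T)" using \<open>P S\<close> unfolding P_def by auto
  next
    fix K assume K: "\<forall>S\<in>K. P S"
    have "openin X (\<Union>S\<in>K. {x \<in> topspace X. f x \<in> S})"
      using K unfolding P_def by blast
    also have "(\<Union>S\<in>K. {x \<in> topspace X. f x \<in> S}) = {x \<in> topspace X. f x \<in> \<Union>K}" by auto
    finally show "P (\<Union>K)" using K unfolding P_def by blast
  qed
  then have op: "openin (topology P) = P" by (simp add: topology_inverse')
  have "{x \<in> topspace X. f x \<in> f ` topspace X} = topspace X" by auto
  then have "P (f ` topspace X)" unfolding P_def by simp
  then have ts: "topspace (topology P) = f ` topspace X"
    unfolding topspace_def[of "topology P"] op by (auto simp: P_def)
  have "quotient_map X (topology P) f"
    unfolding quotient_map_def ts op by (auto simp: P_def)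
  then show ?thesis using that by blast
qed

lemma fibration_homotopy_lifting:
  fixes Y :: "'y topology" and E :: "'e topology" and B :: "'b topology"
  assumes "fibration E B p"
  shows "homotopy_lifting Y E B p"
  unfolding homotopy_lifting_def
proof (intro allI impI; elim conjE)
  fix f H
  let ?I = "top_of_set {0..1::real}"
  assume f: "continuous_map Y E f" and H: "continuous_map (prod_topology ?I Y) B H"
    and H0: "\<forall>y\<in>topspace Y. H (0, y) = p (f y)"
  define q :: "'y \<Rightarrow> 'e \<times> (real \<Rightarrow> 'b)" where "q = (\<lambda>y. (f y, \<lambda>t. H (t, y)))"
  obtain Q where Q: "quotient_map Y Q q" by (rule quotient_topology_exists)
  have "locally_compact_space ?I"
    by (simp add: compact_imp_locally_compact_space compact_space_subtopology)
  moreover have "Hausdorff_space ?I"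
    by (simp add: Hausdorff_space_subtopology)
  ultimately have QI: "quotient_map (prod_topology ?I Y) (prod_topology ?I Q) (\<lambda>(t, y). (t, q y))"
    using quotient_map_prod_right Q by blast
  have "continuous_map Q E fst"
    using Q f by (rule_tac continuous_compose_quotient_map[OF Q]) (simp add: q_def comp_def)
  moreover have "continuous_map (prod_topology ?I Q) B (\<lambda>(t, z). snd z t)"
    by (rule continuous_compose_quotient_map[OF QI]) (use H in \<open>simp add: q_def comp_def case_prod_unfold\<close>)
  moreover have "\<forall>z\<in>topspace Q. snd z 0 = p (fst z)"
  proof
    fix z assume "z \<in> topspace Q"
    then obtain y where "y \<in> topspace Y" "z = q y" using Q unfolding quotient_map_def by blast
    then show "snd z 0 = p (fst z)" using H0 by (simp add: q_def)
  qed
  moreover have "homotopy_lifting Q E B p" using assms unfolding fibration_def by blast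
  ultimately obtain G where G: "continuous_map (prod_topology ?I Q) E G"
      "\<forall>z\<in>topspace Q. G (0, z) = fst z"
      "\<forall>t\<in>{0..1}. \<forall>z\<in>topspace Q. p (G (t, z)) = snd z t"
    unfolding homotopy_lifting_def by (drule_tac x=fst in spec, drule_tac x="\<lambda>(t, z). snd z t" in spec) auto
  have "continuous_map (prod_topology ?I Y) E (G \<circ> (\<lambda>(t, y). (t, q y)))"
    using QI G(1) continuous_map_compose quotient_imp_continuous_map by blast
  moreover have "q y \<in> topspace Q" if "y \<in> topspace Y" for y
    using Q that by (auto simp: quotient_map_def)
  ultimately show "\<exists>G. continuous_map (prod_topology ?I Y) E G \<and> (\<forall>y\<in>topspace Y. G (0, y) = f y) \<and>
      (\<forall>t\<in>{0..1}. \<forall>y\<in>topspace Y. p (G (t, y)) = H (t, y))"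
    using G by (intro exI[of _ "G \<circ> (\<lambda>(t, y). (t, q y))"]) (auto simp: q_def)
qed

lemma genus_le_mono:
  assumes "genus_le E B p j" "j \<le> k"
  shows "genus_le E B p k"
proof -
  obtain U where U: "(\<Union>i<j. U i) = topspace B"
      "\<forall>i<j. openin B (U i) \<and> (\<exists>s. continuous_map (subtopology B (U i)) E s \<and> (\<forall>x\<in>U i. p (s x) = x))"
    using assms(1) unfolding genus_le_def by blast
  define V where "V i = (if i < j then U i else {})" for i
  have e: "continuous_map (subtopology B {}) E s" for s
    by (simp add: continuous_map_def)
  have "(\<Union>i<k. V i) = topspace B"
    using U(1) assms(2) by (fastforce simp: V_def split: if_splits)
  then show ?thesis
    unfolding genus_le_def using U(2) e by (intro exI[of _ V]) (auto simp: V_def)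
qed

lemma genus_le_enat_iff: "genus E B p \<le> enat k \<longleftrightarrow> genus_le E B p k"
proof
  assume le: "genus E B p \<le> enat k"
  let ?S = "{enat k | k. genus_le E B p k}"
  have "?S \<noteq> {}"
  proof
    assume "?S = {}"
    then have "genus E B p = \<infinity>" unfolding genus_def by (simp only: Inf_enat_def) simp
    with le show False by simp
  qed
  then have "genus E B p \<in> ?S"
    unfolding genus_def Inf_enat_def by (metis (no_types, lifting) LeastI all_not_in_conv)
  then show "genus_le E B p k" using le genus_le_mono by fastforce
next
  assume "genus_le E B p k"
  then show "genus E B p \<le> enat k" unfolding genus_def by (auto intro: Inf_lower)
qed

lemma genus_le_pullback_iff:
  "genus_le (pullback_space A E f p) A fst k \<longleftrightarrow>
     (\<exists>U :: nat \<Rightarrow> 'a set. (\<Union>i<k. U i) = topspace A \<and>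
        (\<forall>i<k. openin A (U i) \<and>
           (\<exists>s. continuous_map (subtopology A (U i)) E s \<and> (\<forall>x\<in>U i. p (s x) = f x))))"
proof -
  have "(\<exists>s. continuous_map (subtopology A U) (pullback_space A E f p) s \<and> (\<forall>x\<in>U. fst (s x) = x)) \<longleftrightarrow>
        (\<exists>s. continuous_map (subtopology A U) E s \<and> (\<forall>x\<in>U. p (s x) = f x))" (is "?L \<longleftrightarrow> ?R")
    if "openin A U" for U
  proof
    assume ?L
    then obtain s where s: "continuous_map (subtopology A U) (pullback_space A E f p) s" "\<forall>x\<in>U. fst (s x) = x"
      by blast
    have UA: "U \<subseteq> topspace A" using that openin_subset by blast
    have "continuous_map (subtopology A U) E (snd \<circ> s)"
      using s(1) unfolding pullback_space_def continuous_map_in_subtopology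
      using continuous_map_compose continuous_map_snd by blast
    moreover have "p (snd (s x)) = f x" if "x \<in> U" for x
    proof -
      have "x \<in> topspace (subtopology A U)" using UA that by auto
      moreover have "s \<in> topspace (subtopology A U) \<rightarrow> {(a, e). f a = p e}"
        using s(1) unfolding pullback_space_def continuous_map_in_subtopology by (rule conjunct2)
      ultimately have "s x \<in> {(a, e). f a = p e}" by (rule funcset_mem[rotated])
      then have "f (fst (s x)) = p (snd (s x))" by (simp add: case_prod_unfold)
      then show ?thesis using s(2) that by simp
    qed
    ultimately show ?R by (intro exI[of _ "snd \<circ> s"]) auto
  next
    assume ?R
    then obtain s where s: "continuous_map (subtopology A U) E s" "\<forall>x\<in>U. p (s x) = f x" by blast
    then have "continuous_map (subtopology A U) (pullback_space A E f p) (\<lambda>x. (x, s x))"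
      unfolding pullback_space_def continuous_map_in_subtopology
      by (auto simp: continuous_map_paired continuous_map_from_subtopology)
    then show ?L by (intro exI[of _ "\<lambda>x. (x, s x)"]) auto
  qed
  then show ?thesis unfolding genus_le_def by (simp cong: conj_cong)
qed

lemma pullback_cochain_coboundary:
  assumes f: "continuous_map A B f"
  shows "pullback_cochain A (n + 1) f (coboundary B n c) = coboundary A n (pullback_cochain A n f c)"
proof
  fix \<sigma>
  show "pullback_cochain A (n + 1) f (coboundary B n c) \<sigma> = coboundary A n (pullback_cochain A n f c) \<sigma>"
  proof (cases "0 \<le> n \<and> singular_simplex (nat (n + 1)) A \<sigma>")
    case True
    then obtain m where m: "n = int m" using nonneg_int_cases by blast
    have s: "singular_simplex (Suc m) A \<sigma>" using True m by (simp add: nat_add_distrib)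
    have s': "singular_simplex (Suc m) B (simplex_map (Suc m) f \<sigma>)"
      using s f singular_simplex_simplex_map by blast
    have "singular_face (Suc m) k (simplex_map (Suc m) f \<sigma>) = simplex_map m f (singular_face (Suc m) k \<sigma>)"
      and "singular_simplex m A (singular_face (Suc m) k \<sigma>)" if "k \<le> Suc m" for k
      using that singular_simplex_singular_face[OF s]
      by (auto simp: singular_face_def simplex_map_def simplical_face_in_standard_simplex fun_eq_iff)
    then show ?thesis
      using s s' m by (simp add: pullback_cochain_def coboundary_def nat_add_distrib)
  qed (auto simp: pullback_cochain_def coboundary_def)
qed

lemma pullback_cochain_in_cochains:
  assumes "c \<in> cochains B n"
  shows "pullback_cochain A n f c \<in> cochains A n"
  using assms by (auto simp: pullback_cochain_def cochains_def)

lemma coboundary_add: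
  "coboundary X n (\<lambda>\<sigma>. a \<sigma> + b \<sigma>) = (\<lambda>\<sigma>. coboundary X n a \<sigma> + coboundary X n b \<sigma>)"
  by (auto simp: coboundary_def sum.distrib distrib_left fun_eq_iff)

lemma coboundary_diff:
  "coboundary X n (\<lambda>\<sigma>. a \<sigma> - b \<sigma>) = (\<lambda>\<sigma>. coboundary X n a \<sigma> - coboundary X n b \<sigma>)"
  by (auto simp: coboundary_def sum_subtractf right_diff_distrib fun_eq_iff)

lemma cochains_add: "a \<in> cochains X n \<Longrightarrow> b \<in> cochains X n \<Longrightarrow> (\<lambda>\<sigma>. a \<sigma> + b \<sigma>) \<in> cochains X n"
  unfolding cochains_def by (auto, (metis add_0)+)

lemma cochains_diff: "a \<in> cochains X n \<Longrightarrow> b \<in> cochains X n \<Longrightarrow> (\<lambda>\<sigma>. a \<sigma> - b \<sigma>) \<in> cochains X n"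
  unfolding cochains_def by (auto, (metis diff_self)+)

lemma cohomology_class_eqI:
  assumes b: "b \<in> cochains X (n - 1)" and c: "c = (\<lambda>\<sigma>. d \<sigma> + coboundary X (n - 1) b \<sigma>)"
  shows "cohomology_class X n c = cohomology_class X n d"
proof (intro subset_antisym subsetI)
  fix x assume "x \<in> cohomology_class X n c"
  then obtain e where e: "e \<in> cochains X (n - 1)" "x = (\<lambda>\<sigma>. c \<sigma> + coboundary X (n - 1) e \<sigma>)"
    unfolding cohomology_class_def by blast
  have "x = (\<lambda>\<sigma>. d \<sigma> + coboundary X (n - 1) (\<lambda>\<sigma>. b \<sigma> + e \<sigma>) \<sigma>)"
    unfolding e c coboundary_add by (simp add: algebra_simps)
  then show "x \<in> cohomology_class X n d"
    unfolding cohomology_class_def using cochains_add[OF b e(1)] by blast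
next
  fix x assume "x \<in> cohomology_class X n d"
  then obtain e where e: "e \<in> cochains X (n - 1)" "x = (\<lambda>\<sigma>. d \<sigma> + coboundary X (n - 1) e \<sigma>)"
    unfolding cohomology_class_def by blast
  have "x = (\<lambda>\<sigma>. c \<sigma> + coboundary X (n - 1) (\<lambda>\<sigma>. e \<sigma> - b \<sigma>) \<sigma>)"
    unfolding e c coboundary_diff by (simp add: algebra_simps)
  then show "x \<in> cohomology_class X n c"
    unfolding cohomology_class_def using cochains_diff[OF e(1) b] by blast
qed

lemma pullback_class_cohomology_class:
  assumes f: "continuous_map A B f"
  shows "pullback_class A n f (cohomology_class B n c) = cohomology_class A n (pullback_cochain A n f c)"
proof -
  have "cohomology_class A n (pullback_cochain A n f c') = cohomology_class A n (pullback_cochain A n f c)"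
    if c': "c' \<in> cohomology_class B n c" for c'
  proof -
    obtain b where b: "b \<in> cochains B (n - 1)" "c' = (\<lambda>\<sigma>. c \<sigma> + coboundary B (n - 1) b \<sigma>)"
      using c' unfolding cohomology_class_def by blast
    have "pullback_cochain A n f c' = (\<lambda>\<sigma>. pullback_cochain A n f c \<sigma> +
        coboundary A (n - 1) (pullback_cochain A (n - 1) f b) \<sigma>)"
      using pullback_cochain_coboundary[OF f, of "n - 1" b, symmetric]
      by (simp add: b(2) pullback_cochain_def fun_eq_iff)
    then show ?thesis
      using cohomology_class_eqI[OF pullback_cochain_in_cochains[OF b(1)]] by blast
  qed
  moreover have "c \<in> cohomology_class B n c"
    unfolding cohomology_class_def
    by (rule CollectI, rule exI[of _ "\<lambda>_. 0"]) (simp add: cochains_def coboundary_def fun_eq_iff)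
  ultimately show ?thesis unfolding pullback_class_def by blast
qed

lemma pullback_class_compose:
  assumes f: "continuous_map A B f" and g: "continuous_map A' A g" and u: "u \<in> cohomology B n"
  shows "pullback_class A' n (f \<circ> g) u = pullback_class A' n g (pullback_class A n f u)"
proof -
  obtain c where c: "u = cohomology_class B n c" using u unfolding cohomology_def by blast
  have "pullback_cochain A' n (f \<circ> g) c = pullback_cochain A' n g (pullback_cochain A n f c)"
    using singular_simplex_simplex_map[OF _ g]
    by (auto simp: pullback_cochain_def simplex_map_compose fun_eq_iff)
  then show ?thesis
    by (simp add: c pullback_class_cohomology_class[OF f] pullback_class_cohomology_class[OF g]
        pullback_class_cohomology_class[OF continuous_map_compose[OF g f]])
qed

lemma pullback_class_zero:
  assumes "continuous_map A B f"
  shows "pullback_class A n f (cohomology_zero B n) = cohomology_zero A n"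
  using pullback_class_cohomology_class[OF assms, of n "\<lambda>_. 0"]
  by (simp add: cohomology_zero_def pullback_cochain_def)

lemma le_weight_iff:
  fixes E :: "'e topology" and B :: "'b topology"
  assumes "1 \<le> k"
  shows "enat k \<le> weight E B p n u \<longleftrightarrow>
    (\<forall>(A :: ('b \<times> (nat \<Rightarrow> 'e option)) topology) f.
        continuous_map A B f \<and> genus (pullback_space A E f p) A fst \<le> enat k \<longrightarrow>
        pullback_class A n f u = cohomology_zero A n)" (is "_ \<longleftrightarrow> ?P k")
proof
  assume "enat k \<le> weight E B p n u"
  then have "enat (k - 1) < weight E B p n u"
    using assms by (cases "weight E B p n u") auto
  then obtain j where j: "?P j" "k - 1 < j"
    unfolding weight_def less_Sup_iff by (auto simp del: split_paired_All)
  then have jk: "enat k \<le> enat j" by simp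
  show "?P k"
  proof (intro allI impI)
    fix A :: "('b \<times> (nat \<Rightarrow> 'e option)) topology" and f
    assume "continuous_map A B f \<and> genus (pullback_space A E f p) A fst \<le> enat k"
    then show "pullback_class A n f u = cohomology_zero A n"
      using j(1) order_trans[OF _ jk] by simp
  qed
next
  assume "?P k"
  then show "enat k \<le> weight E B p n u"
    unfolding weight_def using assms by (intro Sup_upper) blast
qed

lemma le_weightD:
  fixes E :: "'e topology" and B :: "'b topology" and A :: "'a topology"
  assumes k: "1 \<le> k" "enat k \<le> weight E B p n u" and u: "u \<in> cohomology B n"
    and f: "continuous_map A B f" and g: "genus (pullback_space A E f p) A fst \<le> enat k"
  shows "pullback_class A n f u = cohomology_zero A n"
proof -
  from g[unfolded genus_le_enat_iff genus_le_pullback_iff] obtain U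
    where *: "(\<Union>i<k. U i) = topspace A \<and> (\<forall>i<k. openin A (U i) \<and>
      (\<exists>s. continuous_map (subtopology A (U i)) E s \<and> (\<forall>x\<in>U i. p (s x) = f x)))" by (rule exE)
  from * have U: "(\<Union>i<k. U i) = topspace A" "\<forall>i<k. openin A (U i)" by simp_all
  from * have sec_ex: "\<exists>s. continuous_map (subtopology A (U i)) E s \<and> (\<forall>x\<in>U i. p (s x) = f x)"
    if "i < k" for i using that by simp
  define s where "s i = (SOME s. continuous_map (subtopology A (U i)) E s \<and> (\<forall>x\<in>U i. p (s x) = f x))" for i
  have "continuous_map (subtopology A (U i)) E (s i) \<and> (\<forall>x\<in>U i. p (s i x) = f x)" if "i < k" for i
    unfolding s_def using sec_ex[OF that] by (rule someI_ex)
  then have s: "\<And>i. i < k \<Longrightarrow> continuous_map (subtopology A (U i)) E (s i)"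
      "\<And>i x. i < k \<Longrightarrow> x \<in> U i \<Longrightarrow> p (s i x) = f x" by simp_all
  define q :: "'a \<Rightarrow> 'b \<times> (nat \<Rightarrow> 'e option)" where
    "q = (\<lambda>a. (f a, \<lambda>i. if i < k \<and> a \<in> U i then Some (s i a) else None))"
  obtain Q where Q: "quotient_map A Q q" by (rule quotient_topology_exists)
  have tQ: "topspace Q = q ` topspace A" using Q by (simp add: quotient_map_def)
  have cQ: "continuous_map Q B fst"
    by (rule continuous_compose_quotient_map[OF Q]) (use f in \<open>simp add: q_def comp_def\<close>)
  define V where "V i = {z \<in> topspace Q. snd z i \<noteq> None}" for i
  have pre: "{a \<in> topspace A. q a \<in> V i} = U i" if "i < k" for i
    using U that openin_subset[of A "U i"] by (auto simp: V_def tQ q_def split: if_splits)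
  have V: "openin Q (V i)" if "i < k" for i
  proof -
    have "V i \<subseteq> topspace Q" by (auto simp: V_def)
    moreover have "openin A {a \<in> topspace A. q a \<in> V i}" using pre[OF that] U(2) that by simp
    ultimately show ?thesis using Q unfolding quotient_map_def by simp
  qed
  have sec: "continuous_map (subtopology Q (V i)) E (\<lambda>z. the (snd z i))" if i: "i < k" for i
  proof (rule continuous_compose_quotient_map)
    show "quotient_map (subtopology A (U i)) (subtopology Q (V i)) q"
      using quotient_map_restriction[OF Q pre[OF i]] V[OF i] by blast
    show "continuous_map (subtopology A (U i)) E ((\<lambda>z. the (snd z i)) \<circ> q)"
      by (rule continuous_map_eq[OF s(1)[OF i]]) (use i in \<open>auto simp: q_def\<close>)
  qed
  have "(\<Union>i<k. V i) = topspace Q"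
    using U(1) by (fastforce simp: V_def tQ q_def)
  moreover have "p (the (snd z i)) = fst z" if "i < k" "z \<in> V i" for i z
    using that s(2) by (auto simp: V_def tQ q_def split: if_splits)
  ultimately have "(\<Union>i<k. V i) = topspace Q \<and> (\<forall>i<k. openin Q (V i) \<and>
      (\<exists>s. continuous_map (subtopology Q (V i)) E s \<and> (\<forall>z\<in>V i. p (s z) = fst z)))"
    using V sec by blast
  then have "genus_le (pullback_space Q E fst p) Q fst k"
    unfolding genus_le_pullback_iff by (rule exI[of _ V])
  then have z: "pullback_class Q n fst u = cohomology_zero Q n"
    using k(2) cQ unfolding le_weight_iff[OF k(1)] genus_le_enat_iff by simp
  have "pullback_class A n (fst \<circ> q) u = pullback_class A n q (cohomology_zero Q n)"
    using pullback_class_compose[OF cQ quotient_imp_continuous_map[OF Q] u] z by simp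
  then show ?thesis
    using pullback_class_zero[OF quotient_imp_continuous_map[OF Q]] by (simp add: q_def comp_def)
qed

end

theory Submission
  imports Defs "HOL-Library.Function_Algebras"
begin

text \<open>
  Suppose that the genus of \<open>p\<close> were at most \<open>wgt \<beta> + min (wgt \<alpha>) (wgt \<gamma>)\<close>.

  If the genus is a finite number \<open>g\<close>, write \<open>g = r + s\<close> with \<open>r \<le> wgt \<beta>\<close> and
  \<open>s \<le> wgt \<alpha>, wgt \<gamma>\<close>, and cover \<open>B\<close> by \<open>g\<close> open sets that carry sections.  Over the union \<open>X\<close>
  of \<open>r\<close> of these sets the fibration has genus at most \<open>r\<close>, so \<open>\<beta>\<close> restricts to zero on \<open>X\<close>;
  likewise \<open>\<alpha>\<close> and \<open>\<gamma>\<close> restrict to zero on the union \<open>Y\<close> of the other \<open>s\<close> sets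
  (\<open>trivial_on_union_of_sections\<close>).  Consequently \<open>\<beta>\<close> has a representative \<open>b\<close> that vanishes on all
  simplices in \<open>X\<close>, and \<open>\<alpha>\<close>, \<open>\<gamma>\<close> have representatives \<open>a\<close>, \<open>c\<close> that vanish on all simplices in \<open>Y\<close>.
  Call a simplex small if it lies in \<open>X\<close> or in \<open>Y\<close>.  The products \<open>a \<bullet> b\<close> and \<open>b \<bullet> c\<close> vanish on small
  simplices.  Since every chain can be subdivided into small simplices, a cocycle that
  vanishes on small simplices is the coboundary of a cochain that vanishes on small simplices
  (\<open>small_cocycle_is_small_coboundary\<close>).  So \<open>a \<bullet> b = d m\<close> and \<open>b \<bullet> c = d l\<close> where \<open>m\<close> and \<open>l\<close> vanish on
  small simplices; then \<open>a \<bullet> l \<plusminus> m \<bullet> c\<close> is a cocycle that vanishes on small simplices and, by the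
  same principle, a coboundary.  Hence the Massey product contains zero
  (\<open>massey_vanishes_if_trivial_on_cover\<close>).  The lemmas \<open>massey_vanishes_change_left\<close>,
  \<open>massey_vanishes_change_middle\<close> and \<open>massey_vanishes_change_right\<close> carry this over to any other
  choice of representatives.

  If the genus is infinite, then \<open>wgt \<beta>\<close> is infinite, or \<open>wgt \<alpha>\<close> and \<open>wgt \<gamma>\<close> both are.  A class
  of infinite weight is zero, because a non-zero class of degree \<open>n\<close> has weight at most \<open>n\<close>
  (\<open>weight_gt_degree_imp_zero\<close>): it stays non-zero on the \<open>n\<close>-skeleton of the geometric realization
  of the singular complex of \<open>B\<close>, and over that skeleton the fibration has genus at most \<open>n + 1\<close>.
  The argument above then applies to the cover by \<open>B\<close> and the empty set.
\<close>

section \<open>The differential graded algebra of singular cochains\<close>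

text \<open>
  With the pointwise operations on functions, cochains form a module over the ring of functions
  from simplices to coefficients.  A sign \<open>(- 1) ^ k\<close> is then a constant function, and the
  identities of the differential graded algebra become equations between functions that ring
  normalization can handle.
\<close>

lemma minus_one_power_apply [simp]: "((- 1) ^ n) x = (- 1 :: 'b::comm_ring_1) ^ n"
  by (induction n) auto

lemma zero_in_cochains [simp]: "0 \<in> cochains X n"
  by (simp add: cochains_def)

lemma plus_in_cochains: "a \<in> cochains X n \<Longrightarrow> b \<in> cochains X n \<Longrightarrow> a + b \<in> cochains X n"
  unfolding plus_fun_def by (rule cochains_add)

lemma diff_in_cochains: "a \<in> cochains X n \<Longrightarrow> b \<in> cochains X n \<Longrightarrow> a - b \<in> cochains X n"
  unfolding fun_diff_def by (rule cochains_diff)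

lemma times_in_cochains: "a \<in> cochains X n \<Longrightarrow> r * a \<in> cochains X n"
  unfolding cochains_def by (auto, (metis mult_zero_right)+)

lemma coboundary_in_cochains: "coboundary X n a \<in> cochains X (n + 1)"
  by (auto simp: cochains_def coboundary_def)

lemma cup_in_cochains: "cup X m n a b \<in> cochains X (m + n)"
  by (auto simp: cochains_def cup_def)

lemma coboundary_zero [simp]: "coboundary X n 0 = 0"
  by (simp add: coboundary_def fun_eq_iff)

lemma coboundary_plus: "coboundary X n (a + b) = coboundary X n a + coboundary X n b"
  unfolding plus_fun_def by (rule coboundary_add)

lemma coboundary_minus: "coboundary X n (a - b) = coboundary X n a - coboundary X n b"
  unfolding fun_diff_def by (rule coboundary_diff)

lemma coboundary_sign: "coboundary X n ((- 1) ^ k * a) = (- 1) ^ k * coboundary X n a"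
  by (auto simp: coboundary_def fun_eq_iff sum_distrib_left mult.left_commute)

lemma coboundary_negative_degree: "n < 0 \<Longrightarrow> coboundary X n a = 0"
  by (simp add: coboundary_def fun_eq_iff)

lemma cup_zero_left [simp]: "cup X m n 0 b = 0"
  and cup_zero_right [simp]: "cup X m n a 0 = 0"
  by (simp_all add: cup_def fun_eq_iff)

lemma cup_plus_left: "cup X m n (a + a') b = cup X m n a b + cup X m n a' b"
  and cup_plus_right: "cup X m n a (b + b') = cup X m n a b + cup X m n a b'"
  by (simp_all add: cup_def fun_eq_iff algebra_simps)

lemma cup_sign_left: "cup X m n ((- 1) ^ k * a) b = (- 1) ^ k * cup X m n a b"
  and cup_sign_right: "cup X m n a ((- 1) ^ k * b) = (- 1) ^ k * cup X m n a b"
  by (simp_all add: cup_def fun_eq_iff)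

text \<open>
  The inclusion of the standard \<open>q\<close>-simplex as the last face of the standard \<open>(p + q)\<close>-simplex, along
  which back faces are formed.
\<close>

lemma shift_in_standard_simplex:
  assumes "t \<in> standard_simplex q"
  shows "(\<lambda>i. if i < p then 0 else t (i - p)) \<in> standard_simplex (p + q)"
proof -
  have "(\<Sum>i\<le>p + q. if i < p then 0 else t (i - p)) = (\<Sum>i\<in>{p..p + q}. t (i - p))"
    by (rule sum.mono_neutral_cong_right) auto
  also have "\<dots> = (\<Sum>i\<le>q. t i)"
    by (rule sum.reindex_bij_witness[of _ "\<lambda>i. i + p" "\<lambda>i. i - p"]) auto
  finally show ?thesis
    using assms by (auto simp: standard_simplex_def)
qed

lemma singular_simplex_front_face:
  assumes "singular_simplex (p + q) X \<sigma>"
  shows "singular_simplex p X (front_face p \<sigma>)"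
  using assms standard_simplex_mono[of p "p + q"]
  by (auto simp: singular_simplex_def front_face_def intro: continuous_map_from_subtopology_mono)

lemma singular_simplex_back_face:
  assumes "singular_simplex (p + q) X \<sigma>"
  shows "singular_simplex q X (back_face p q \<sigma>)"
proof -
  let ?PT = "powertop_real UNIV" and ?f = "\<lambda>t i. if i < p then 0 else t (i - p) :: real"
  have "continuous_map ?PT euclideanreal (\<lambda>t. ?f t i)" for i
    by (auto intro: continuous_map_product_projection)
  then have "continuous_map (subtopology ?PT (standard_simplex q)) ?PT ?f"
    by (simp add: continuous_map_componentwise_UNIV continuous_map_from_subtopology)
  then have "continuous_map (subtopology ?PT (standard_simplex q))
      (subtopology ?PT (standard_simplex (p + q))) ?f"
    by (auto simp: continuous_map_in_subtopology shift_in_standard_simplex)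
  then have "continuous_map (subtopology ?PT (standard_simplex q)) X (\<sigma> \<circ> ?f)"
    using assms continuous_map_compose unfolding singular_simplex_def by blast
  then show ?thesis
    by (simp add: singular_simplex_def back_face_def comp_def)
qed

lemma front_face_singular_face:
  assumes "k \<le> p"
  shows "front_face p (singular_face (Suc (p + q)) k \<sigma>) =
    singular_face (Suc p) k (front_face (Suc p) \<sigma>)"
proof
  fix t :: "nat \<Rightarrow> real"
  have "simplical_face k t \<in> standard_simplex (Suc p)" "t \<in> standard_simplex (p + q)"
    if "t \<in> standard_simplex p"
    using that assms simplical_face_in_standard_simplex[of "Suc p" k t]
      standard_simplex_mono[of p "p + q"] by auto
  then show "front_face p (singular_face (Suc (p + q)) k \<sigma>) t =
      singular_face (Suc p) k (front_face (Suc p) \<sigma>) t"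
    by (simp add: front_face_def singular_face_def)
qed

lemma back_face_singular_face:
  assumes "k \<le> p"
  shows "back_face p q (singular_face (Suc (p + q)) k \<sigma>) = back_face (Suc p) q \<sigma>"
proof
  fix t :: "nat \<Rightarrow> real"
  have "simplical_face k (\<lambda>i. if i < p then 0 else t (i - p)) = (\<lambda>i. if i < Suc p then 0 else t (i - Suc p))"
    using assms by (auto simp: simplical_face_def fun_eq_iff)
  then show "back_face p q (singular_face (Suc (p + q)) k \<sigma>) t = back_face (Suc p) q \<sigma> t"
    using shift_in_standard_simplex[of t q p]
    by (simp add: back_face_def singular_face_def)
qed

lemma front_face_singular_face':
  assumes "p < k"
  shows "front_face p (singular_face (Suc (p + q)) k \<sigma>) = front_face p \<sigma>"
proof
  fix t :: "nat \<Rightarrow> real"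
  have "simplical_face k t = t" "t \<in> standard_simplex (p + q)" if "t \<in> standard_simplex p"
    using that assms standard_simplex_mono[of p "p + q"]
    by (auto simp: simplical_face_def standard_simplex_def fun_eq_iff)
  then show "front_face p (singular_face (Suc (p + q)) k \<sigma>) t = front_face p \<sigma> t"
    by (simp add: front_face_def singular_face_def)
qed

lemma back_face_singular_face':
  assumes "l \<le> Suc q" "1 \<le> l"
  shows "back_face p q (singular_face (Suc (p + q)) (p + l) \<sigma>) =
    singular_face (Suc q) l (back_face p (Suc q) \<sigma>)"
proof
  fix t :: "nat \<Rightarrow> real"
  have "simplical_face (p + l) (\<lambda>i. if i < p then 0 else t (i - p)) =
      (\<lambda>i. if i < p then 0 else simplical_face l t (i - p))"
    using assms by (auto simp: simplical_face_def fun_eq_iff)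
  moreover have "simplical_face l t \<in> standard_simplex (Suc q)" if "t \<in> standard_simplex q"
    using that assms simplical_face_in_standard_simplex[of "Suc q" l t] by auto
  ultimately show "back_face p q (singular_face (Suc (p + q)) (p + l) \<sigma>) t =
      singular_face (Suc q) l (back_face p (Suc q) \<sigma>) t"
    using shift_in_standard_simplex[of t q p]
    by (simp add: back_face_def singular_face_def)
qed

lemma singular_face_last_front_face:
  "singular_face (Suc p) (Suc p) (front_face (Suc p) \<sigma>) = front_face p \<sigma>"
proof
  fix t :: "nat \<Rightarrow> real"
  have "simplical_face (Suc p) t = t" "t \<in> standard_simplex (Suc p)" if "t \<in> standard_simplex p"
    using that standard_simplex_mono[of p "Suc p"]
    by (auto simp: simplical_face_def standard_simplex_def fun_eq_iff)
  then show "singular_face (Suc p) (Suc p) (front_face (Suc p) \<sigma>) t = front_face p \<sigma> t"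
    by (simp add: front_face_def singular_face_def)
qed

lemma singular_face_zero_back_face:
  "singular_face (Suc q) 0 (back_face p (Suc q) \<sigma>) = back_face (Suc p) q \<sigma>"
proof
  fix t :: "nat \<Rightarrow> real"
  have "(\<lambda>i. if i < p then 0 else simplical_face 0 t (i - p)) =
      (\<lambda>i. if i < Suc p then 0 else t (i - Suc p))"
    by (auto simp: simplical_face_def fun_eq_iff)
  moreover have "simplical_face 0 t \<in> standard_simplex (Suc q)" if "t \<in> standard_simplex q"
    using that simplical_face_in_standard_simplex[of "Suc q" 0 t] by auto
  ultimately show "singular_face (Suc q) 0 (back_face p (Suc q) \<sigma>) t = back_face (Suc p) q \<sigma> t"
    by (simp add: back_face_def singular_face_def)
qed

text \<open>
  The faces \<open>0, \<dots>, p\<close> of a \<open>(p + q + 1)\<close>-simplex act on the front face, the remaining ones on the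
  back face.  The two terms on the right without counterpart on the left, the last face of the
  front and the zeroth face of the back, cancel.
\<close>

lemma coboundary_cup:
  "coboundary X (m + n) (cup X m n a b) =
     cup X (m + 1) n (coboundary X m a) b + (- 1) ^ nat m * cup X m (n + 1) a (coboundary X n b)"
proof (cases "0 \<le> m \<and> 0 \<le> n")
  case True
  then obtain p q where [simp]: "m = int p" "n = int q"
    by (metis nonneg_int_cases)
  show ?thesis
  proof
    fix \<sigma>
    show "coboundary X (m + n) (cup X m n a b) \<sigma> = (cup X (m + 1) n (coboundary X m a) b +
        (- 1) ^ nat m * cup X m (n + 1) a (coboundary X n b)) \<sigma>"
    proof (cases "singular_simplex (Suc (p + q)) X \<sigma>")
      case \<sigma>: True
      have [simp]: "nat (int p + int q) = p + q" "nat (int p + int q + 1) = Suc (p + q)"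
        "nat (int p + 1 + int q) = Suc (p + q)" "nat (int p + (int q + 1)) = Suc (p + q)"
        "nat (int p + 1) = Suc p" "nat (int q + 1) = Suc q" by linarith+
      define A where "A k = a (singular_face (Suc p) k (front_face (Suc p) \<sigma>))" for k
      define C where "C k = b (singular_face (Suc q) k (back_face p (Suc q) \<sigma>))" for k
      let ?f = "\<lambda>k. (- 1) ^ k * (a (front_face p (singular_face (Suc (p + q)) k \<sigma>)) *
          b (back_face p q (singular_face (Suc (p + q)) k \<sigma>)))"
      have fc: "singular_simplex (p + q) X (singular_face (Suc (p + q)) k \<sigma>)" if "k \<le> Suc (p + q)" for k
        using singular_simplex_singular_face[OF \<sigma>, of k] that by simp
      have fr: "singular_simplex (Suc p) X (front_face (Suc p) \<sigma>)"
        using singular_simplex_front_face[of "Suc p" q] \<sigma> by simp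
      have bk: "singular_simplex (Suc q) X (back_face p (Suc q) \<sigma>)"
        using singular_simplex_back_face[of p "Suc q"] \<sigma> by simp
      have "coboundary X (m + n) (cup X m n a b) \<sigma> = (\<Sum>k\<le>Suc (p + q). ?f k)"
        using \<sigma> fc by (simp add: coboundary_def cup_def)
      also have "{..Suc (p + q)} = {..p} \<union> {Suc p..Suc (p + q)}" by auto
      also have "sum ?f ({..p} \<union> {Suc p..Suc (p + q)}) = sum ?f {..p} + sum ?f {Suc p..Suc (p + q)}"
        by (rule sum.union_disjoint) auto
      also have "sum ?f {..p} = (\<Sum>k\<le>p. (- 1) ^ k * A k) * C 0"
        unfolding sum_distrib_right
        by (rule sum.cong) (simp_all add: A_def C_def front_face_singular_face back_face_singular_face
            singular_face_zero_back_face mult.assoc)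
      also have "sum ?f {Suc p..Suc (p + q)} = (\<Sum>k\<in>{1..Suc q}. ?f (p + k))"
        by (rule sum.reindex_bij_witness[of _ "\<lambda>k. p + k" "\<lambda>k. k - p"]) auto
      also have "\<dots> = (- 1) ^ p * (A (Suc p) * (\<Sum>k\<in>{1..Suc q}. (- 1) ^ k * C k))"
        unfolding sum_distrib_left
        by (rule sum.cong) (simp_all add: A_def C_def front_face_singular_face' back_face_singular_face'
            singular_face_last_front_face power_add mult_ac)
      finally have L: "coboundary X (m + n) (cup X m n a b) \<sigma> = (\<Sum>k\<le>p. (- 1) ^ k * A k) * C 0 +
          (- 1) ^ p * (A (Suc p) * (\<Sum>k\<in>{1..Suc q}. (- 1) ^ k * C k))" .
      have "{..Suc q} = insert 0 {1..Suc q}" by auto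
      then have "(\<Sum>k\<le>Suc q. (- 1) ^ k * C k) = C 0 + (\<Sum>k\<in>{1..Suc q}. (- 1) ^ k * C k)" by simp
      then have "(cup X (m + 1) n (coboundary X m a) b +
          (- 1) ^ nat m * cup X m (n + 1) a (coboundary X n b)) \<sigma> =
          ((\<Sum>k\<le>p. (- 1) ^ k * A k) + (- 1) ^ Suc p * A (Suc p)) * C 0 +
          (- 1) ^ p * (A (Suc p) * (C 0 + (\<Sum>k\<in>{1..Suc q}. (- 1) ^ k * C k)))"
        using \<sigma> fr bk
        by (simp add: cup_def coboundary_def singular_face_last_front_face
            singular_face_zero_back_face[symmetric] flip: A_def C_def)
           (simp add: A_def C_def singular_face_last_front_face algebra_simps)
      then show ?thesis
        unfolding L by (simp add: algebra_simps)
    qed (auto simp: coboundary_def cup_def nat_add_distrib)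
  qed
next
  case False
  then have "cup X m n a b = 0" "cup X (m + 1) n (coboundary X m a) b = 0"
    "cup X m (n + 1) a (coboundary X n b) = 0"
    by (auto simp: cup_def coboundary_def fun_eq_iff)
  then show ?thesis by simp
qed

lemma cup_assoc:
  "cup X (l + m) n (cup X l m a b) c = cup X l (m + n) a (cup X m n b c)"
proof
  fix \<sigma>
  show "cup X (l + m) n (cup X l m a b) c \<sigma> = cup X l (m + n) a (cup X m n b c) \<sigma>"
  proof (cases "0 \<le> l \<and> 0 \<le> m \<and> 0 \<le> n \<and> singular_simplex (nat (l + m + n)) X \<sigma>")
    case True
    then obtain p q r where [simp]: "l = int p" "m = int q" "n = int r"
      by (metis nonneg_int_cases)
    have [simp]: "nat (int p + int q) = p + q" "nat (int q + int r) = q + r"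
      "nat (int p + int q + int r) = p + q + r" "nat (int p + (int q + int r)) = p + q + r" by linarith+
    have \<sigma>: "singular_simplex (p + q + r) X \<sigma>" using True by simp
    have "singular_simplex (p + q) X (front_face (p + q) \<sigma>)"
      using singular_simplex_front_face[OF \<sigma>] .
    moreover have "singular_simplex (q + r) X (back_face p (q + r) \<sigma>)"
      using singular_simplex_back_face[of p "q + r"] \<sigma> by (simp add: add.assoc)
    moreover have "front_face p (front_face (p + q) \<sigma>) = front_face p \<sigma>"
      using standard_simplex_mono[of p "p + q"] by (auto simp: front_face_def fun_eq_iff)
    moreover have "back_face p q (front_face (p + q) \<sigma>) = front_face q (back_face p (q + r) \<sigma>)"
      using standard_simplex_mono[of q "q + r"] shift_in_standard_simplex[of _ q p]
      by (auto simp: front_face_def back_face_def fun_eq_iff)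
    moreover have "back_face (p + q) r \<sigma> = back_face q r (back_face p (q + r) \<sigma>)"
    proof
      fix t :: "nat \<Rightarrow> real"
      have "(\<lambda>i. if i < p then 0 else if i - p < q then 0 else t (i - p - q)) =
          (\<lambda>i. if i < p + q then 0 else t (i - (p + q)))"
        by (auto simp: fun_eq_iff)
      then show "back_face (p + q) r \<sigma> t = back_face q r (back_face p (q + r) \<sigma>) t"
        using shift_in_standard_simplex[of t r q] by (simp add: back_face_def)
    qed
    ultimately show ?thesis
      using \<sigma> by (simp add: cup_def mult.assoc)
  qed (auto simp: cup_def add.assoc)
qed

section \<open>The pairing of cochains and chains\<close>

text \<open>
  The coboundary is dual to the boundary operator of integral chains under this pairing.  That
  transports to cochains with arbitrary coefficients what is known about chains: the boundary
  of a boundary vanishes, and chains can be subdivided.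
\<close>

definition pairing :: "('a, 'r::comm_ring_1) cochain \<Rightarrow> 'a chain \<Rightarrow> 'r" where
  "pairing c x = (\<Sum>\<sigma>\<in>Poly_Mapping.keys x. of_int (poly_mapping.lookup x \<sigma>) * c \<sigma>)"

lemma pairing_superset:
  assumes "finite K" "Poly_Mapping.keys x \<subseteq> K"
  shows "pairing c x = (\<Sum>\<sigma>\<in>K. of_int (poly_mapping.lookup x \<sigma>) * c \<sigma>)"
  unfolding pairing_def
  by (rule sum.mono_neutral_left) (use assms in \<open>auto simp: in_keys_iff\<close>)

lemma pairing_zero [simp]: "pairing c 0 = 0"
  by (simp add: pairing_def)

lemma pairing_frag_of [simp]: "pairing c (frag_of \<sigma>) = c \<sigma>"
  by (simp add: pairing_def)

lemma pairing_add: "pairing c (x + y) = pairing c x + pairing c y"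
  and pairing_diff: "pairing c (x - y) = pairing c x - pairing c y"
proof -
  let ?K = "Poly_Mapping.keys x \<union> Poly_Mapping.keys y"
  have "Poly_Mapping.keys (x + y) \<subseteq> ?K" "Poly_Mapping.keys (x - y) \<subseteq> ?K"
    using keys_add[of x y] keys_diff[of x y] by auto
  then show "pairing c (x + y) = pairing c x + pairing c y" "pairing c (x - y) = pairing c x - pairing c y"
    by (simp_all add: pairing_superset[of ?K] lookup_add lookup_minus distrib_right left_diff_distrib
        sum.distrib sum_subtractf)
qed

lemma pairing_cmul: "pairing c (frag_cmul r x) = of_int r * pairing c x"
  by (simp add: pairing_superset[of "Poly_Mapping.keys x"] keys_cmul sum_distrib_left mult.assoc)

lemma pairing_sum: "pairing c (sum f I) = (\<Sum>i\<in>I. pairing c (f i))"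
  by (induction I rule: infinite_finite_induct) (simp_all add: pairing_add)

lemma pairing_frag_extend: "pairing c (frag_extend f x) = pairing (\<lambda>\<sigma>. pairing c (f \<sigma>)) x"
  unfolding frag_extend_def pairing_sum pairing_cmul by (simp add: pairing_def)

lemma pairing_cong:
  assumes "\<And>\<sigma>. \<sigma> \<in> Poly_Mapping.keys x \<Longrightarrow> c \<sigma> = d \<sigma>"
  shows "pairing c x = pairing d x"
  unfolding pairing_def using assms by simp

lemma coboundary_eq_pairing:
  assumes "singular_simplex (Suc n) X \<sigma>"
  shows "coboundary X (int n) c \<sigma> = pairing c (chain_boundary (Suc n) (frag_of \<sigma>))"
  using assms by (simp add: coboundary_def nat_add_distrib chain_boundary_of pairing_sum pairing_cmul
      del: sum.atMost_Suc)

lemma pairing_coboundary: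
  assumes "singular_chain (Suc n) X x"
  shows "pairing (coboundary X (int n) c) x = pairing c (chain_boundary (Suc n) x)"
proof -
  have "pairing (coboundary X (int n) c) x =
      pairing (\<lambda>\<sigma>. pairing c (chain_boundary (Suc n) (frag_of \<sigma>))) x"
    using assms by (intro pairing_cong coboundary_eq_pairing) (auto simp: singular_chain_def)
  then show ?thesis
    by (simp add: chain_boundary_def pairing_frag_extend)
qed

lemma coboundary_coboundary: "coboundary X (n + 1) (coboundary X n c) = 0"
proof (cases "n \<ge> 0")
  case True
  then obtain m where m: "n = int m" by (metis nonneg_int_cases)
  have "coboundary X (int (Suc m)) (coboundary X (int m) c) \<sigma> = 0" for \<sigma>
  proof (cases "singular_simplex (Suc (Suc m)) X \<sigma>")
    case True
    have "singular_chain (Suc m) X (chain_boundary (Suc (Suc m)) (frag_of \<sigma>))"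
      using True by (intro singular_chain_boundary_alt) (simp add: singular_chain_of)
    moreover have "chain_boundary (Suc m) (chain_boundary (Suc (Suc m)) (frag_of \<sigma>)) = 0"
      using chain_boundary_boundary[of "Suc (Suc m)" X "frag_of \<sigma>"] True by (simp add: singular_chain_of)
    ultimately show ?thesis
      by (simp only: coboundary_eq_pairing[OF True] pairing_coboundary pairing_zero)
  qed (simp add: coboundary_def nat_add_distrib)
  then show ?thesis by (simp add: m fun_eq_iff add.commute)
qed (simp add: coboundary_negative_degree)

section \<open>Cocycles and cohomology classes\<close>

lemma cohomology_class_coboundary:
  assumes "w \<in> cochains X (n - 1)"
  shows "cohomology_class X n (coboundary X (n - 1) w) = cohomology_zero X n"
  unfolding cohomology_zero_def by (rule cohomology_class_eqI[OF assms]) simp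

lemma cohomology_class_eq_zeroD:
  assumes "cohomology_class X n c = cohomology_zero X n"
  obtains b where "b \<in> cochains X (n - 1)" "c = coboundary X (n - 1) b"
proof -
  have "(\<lambda>\<sigma>. c \<sigma> + coboundary X (n - 1) 0 \<sigma>) \<in> cohomology_class X n c"
    unfolding cohomology_class_def by (rule CollectI) (blast intro: zero_in_cochains)
  then have "c \<in> cohomology_zero X n" using assms by simp
  then show ?thesis using that unfolding cohomology_zero_def cohomology_class_def by auto
qed

text \<open>
  A class is recovered from any of its elements, and all its elements are cocycles, since two of
  them differ by a coboundary.
\<close>

lemma cohomology_representative:
  assumes u: "u \<in> cohomology X n" and c: "c \<in> u"
  shows "c \<in> cocycles X n" and "u = cohomology_class X n c"
proof -
  obtain d where d: "d \<in> cocycles X n" "u = cohomology_class X n d"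
    using u unfolding cohomology_def by blast
  obtain b where b: "b \<in> cochains X (n - 1)" "c = (\<lambda>\<sigma>. d \<sigma> + coboundary X (n - 1) b \<sigma>)"
    using c d(2) unfolding cohomology_class_def by blast
  have cd: "c = d + coboundary X (n - 1) b" by (simp add: b(2) fun_eq_iff)
  show "u = cohomology_class X n c"
    using cohomology_class_eqI[OF b] d(2) by simp
  have "coboundary X n d = 0" using d(1) unfolding cocycles_def by (simp add: fun_eq_iff)
  then have "coboundary X n c = 0"
    using coboundary_coboundary[of X "n - 1" b] by (simp add: cd coboundary_plus)
  moreover have "coboundary X (n - 1) b \<in> cochains X n"
    using coboundary_in_cochains[of X "n - 1" b] by simp
  then have "c \<in> cochains X n"
    using d(1) unfolding cd cocycles_def by (intro plus_in_cochains) auto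
  ultimately show "c \<in> cocycles X n" unfolding cocycles_def by (simp add: fun_eq_iff)
qed

lemma cohomology_nonempty:
  assumes "u \<in> cohomology X n"
  shows "(SOME c. c \<in> u) \<in> u"
proof -
  obtain d where u: "u = cohomology_class X n d" using assms unfolding cohomology_def by blast
  have "(\<lambda>\<sigma>. d \<sigma> + coboundary X (n - 1) 0 \<sigma>) \<in> u"
    unfolding u cohomology_class_def by (rule CollectI) (blast intro: zero_in_cochains)
  then show ?thesis by (rule someI[of "\<lambda>c. c \<in> u"])
qed

section \<open>Massey products that contain zero\<close>

text \<open>
  The witness \<open>w\<close> makes the class of the third product zero, so that the statement is about cochains
  only and can be transported along changes of the representatives.
\<close>

definition massey_vanishes :: "'a topology \<Rightarrow> nat \<Rightarrow> nat \<Rightarrow> nat \<Rightarrow> ('a, 'r::comm_ring_1) cochain \<Rightarrow>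
    ('a, 'r) cochain \<Rightarrow> ('a, 'r) cochain \<Rightarrow> bool" where
  "massey_vanishes X i j k a b c \<longleftrightarrow>
     (\<exists>m l w. m \<in> cochains X (int i + int j - 1) \<and> l \<in> cochains X (int j + int k - 1) \<and>
        w \<in> cochains X (int i + int j + int k - 2) \<and>
        coboundary X (int i + int j - 1) m = cup X i j a b \<and>
        coboundary X (int j + int k - 1) l = cup X j k b c \<and>
        cup X i (int j + int k - 1) a l + (- 1) ^ (i + 1) * cup X (int i + int j - 1) k m c =
          coboundary X (int i + int j + int k - 2) w)"

lemma massey_vanishes_imp_zero_in_massey_cocycles:
  assumes "massey_vanishes X i j k a b c"
  shows "cohomology_zero X (int i + int j + int k - 1) \<in> massey_cocycles X i j k a b c"
proof -
  let ?n = "int i + int j + int k - 1"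
  have e: "int i + int j + int k - 2 = ?n - 1" by simp
  obtain m l w where *: "m \<in> cochains X (int i + int j - 1)" "l \<in> cochains X (int j + int k - 1)"
    "w \<in> cochains X (?n - 1)"
    "coboundary X (int i + int j - 1) m = cup X i j a b"
    "coboundary X (int j + int k - 1) l = cup X j k b c"
    "cup X i (int j + int k - 1) a l + (- 1) ^ (i + 1) * cup X (int i + int j - 1) k m c =
      coboundary X (?n - 1) w"
    using assms unfolding massey_vanishes_def e by blast
  have "(\<lambda>\<sigma>. cup X i (int j + int k - 1) a l \<sigma> + (- 1) ^ (i + 1) * cup X (int i + int j - 1) k m c \<sigma>) =
      coboundary X (?n - 1) w"
    unfolding *(6)[symmetric] by (simp add: fun_eq_iff)
  then show ?thesis
    unfolding massey_cocycles_def using *(1,2,4,5) cohomology_class_coboundary[OF *(3)] by force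
qed

text \<open>
  The Leibniz rule for a cochain of degree \<open>i - 1\<close> produces the sign on the left.  At \<open>i = 0\<close> the
  exponents have different parity, but then the cup product has a factor of negative degree and is zero.
\<close>

lemma sign_pred_cup:
  "(- 1) ^ nat (int i - 1) * cup X (int i - 1) n x y = (- 1) ^ (i + 1) * cup X (int i - 1) n x y"
proof (cases i)
  case 0
  then have "cup X (int i - 1) n x y = 0" by (simp add: cup_def fun_eq_iff)
  then show ?thesis by simp
qed (simp add: power_add)

lemma sign_square: "(- 1) ^ n * ((- 1) ^ n * a) = (a :: 'b::comm_ring_1)"
  by (metis mult.assoc mult_1 power_minus_mult left_minus_one_mult_self)

text \<open>
  Replacing \<open>a\<close> by \<open>a + d x\<close> changes \<open>a \<bullet> b\<close> by \<open>d (x \<bullet> b)\<close>, so \<open>m\<close> is replaced by \<open>m + x \<bullet> b\<close>.  The change of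
  the third product is \<open>d x \<bullet> l + (- 1) ^ (i + 1) * x \<bullet> b \<bullet> c = d (x \<bullet> l)\<close>.
\<close>

lemma massey_vanishes_change_left:
  assumes v: "massey_vanishes X i j k a b c" and x: "x \<in> cochains X (int i - 1)"
    and b: "coboundary X j b = 0"
  shows "massey_vanishes X i j k (a + coboundary X (int i - 1) x) b c"
proof -
  obtain m l w where *: "m \<in> cochains X (int i + int j - 1)" "l \<in> cochains X (int j + int k - 1)"
    "w \<in> cochains X (int i + int j + int k - 2)"
    "coboundary X (int i + int j - 1) m = cup X i j a b"
    "coboundary X (int j + int k - 1) l = cup X j k b c"
    "cup X i (int j + int k - 1) a l + (- 1) ^ (i + 1) * cup X (int i + int j - 1) k m c =
      coboundary X (int i + int j + int k - 2) w"
    using v unfolding massey_vanishes_def by blast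
  let ?m = "cup X (int i - 1) j x b" and ?w = "cup X (int i - 1) (int j + int k - 1) x l"
  have e: "int i - 1 + int j = int i + int j - 1"
    "int i - 1 + (int j + int k - 1) = int i + int j + int k - 2" by simp_all
  have c: "?m \<in> cochains X (int i + int j - 1)" "?w \<in> cochains X (int i + int j + int k - 2)"
    using cup_in_cochains[of X "int i - 1" "int j" x b]
      cup_in_cochains[of X "int i - 1" "int j + int k - 1" x l] unfolding e by auto
  have dm: "coboundary X (int i + int j - 1) ?m = cup X i j (coboundary X (int i - 1) x) b"
    using coboundary_cup[of X "int i - 1" "int j" x b] b unfolding e by simp
  have dw: "coboundary X (int i + int j + int k - 2) ?w =
      cup X i (int j + int k - 1) (coboundary X (int i - 1) x) l +
      (- 1) ^ (i + 1) * cup X (int i + int j - 1) k ?m c"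
    using coboundary_cup[of X "int i - 1" "int j + int k - 1" x l] *(5)
      cup_assoc[of X "int i - 1" "int j" "int k" x b c]
    unfolding e by (simp del: power_Suc add: sign_pred_cup)
  show ?thesis
    unfolding massey_vanishes_def
    by (rule exI[of _ "m + ?m"], rule exI[of _ l], rule exI[of _ "w + ?w"])
       (use * c in \<open>simp add: plus_in_cochains coboundary_plus cup_plus_left dm dw flip: *(6)\<close>;
        simp add: algebra_simps)
qed

text \<open>
  Symmetrically, for \<open>c + d z\<close> the cochain \<open>l\<close> is replaced by \<open>l + (- 1) ^ j * b \<bullet> z\<close>, and the third
  product changes by \<open>(- 1) ^ j * d (m \<bullet> z)\<close>.
\<close>

lemma massey_vanishes_change_right:
  assumes v: "massey_vanishes X i j k a b c" and z: "z \<in> cochains X (int k - 1)"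
    and b: "coboundary X j b = 0"
  shows "massey_vanishes X i j k a b (c + coboundary X (int k - 1) z)"
proof -
  obtain m l w where *: "m \<in> cochains X (int i + int j - 1)" "l \<in> cochains X (int j + int k - 1)"
    "w \<in> cochains X (int i + int j + int k - 2)"
    "coboundary X (int i + int j - 1) m = cup X i j a b"
    "coboundary X (int j + int k - 1) l = cup X j k b c"
    "cup X i (int j + int k - 1) a l + (- 1) ^ (i + 1) * cup X (int i + int j - 1) k m c =
      coboundary X (int i + int j + int k - 2) w"
    using v unfolding massey_vanishes_def by blast
  let ?l = "(- 1) ^ j * cup X j (int k - 1) b z"
    and ?w = "(- 1) ^ j * cup X (int i + int j - 1) (int k - 1) m z"
  have e: "int j + (int k - 1) = int j + int k - 1"
    "int i + int j - 1 + (int k - 1) = int i + int j + int k - 2" by simp_all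
  have c: "?l \<in> cochains X (int j + int k - 1)" "?w \<in> cochains X (int i + int j + int k - 2)"
    using cup_in_cochains[of X "int j" "int k - 1" b z]
      cup_in_cochains[of X "int i + int j - 1" "int k - 1" m z]
    unfolding e by (auto intro: times_in_cochains)
  have dl: "coboundary X (int j + int k - 1) ?l = cup X j k b (coboundary X (int k - 1) z)"
    using coboundary_cup[of X "int j" "int k - 1" b z] b unfolding e
    by (simp add: coboundary_sign sign_square)
  have "coboundary X (int i + int j + int k - 2) (cup X (int i + int j - 1) (int k - 1) m z) =
      cup X (int i + int j) (int k - 1) (cup X i j a b) z +
      (- 1) ^ (i + j + 1) * cup X (int i + int j - 1) k m (coboundary X (int k - 1) z)"
    using coboundary_cup[of X "int i + int j - 1" "int k - 1" m z] *(4)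
      sign_pred_cup[of "i + j" X "int k" m "coboundary X (int k - 1) z"]
    unfolding e by simp
  then have dw: "coboundary X (int i + int j + int k - 2) ?w =
      cup X i (int j + int k - 1) a ?l +
      (- 1) ^ (i + 1) * cup X (int i + int j - 1) k m (coboundary X (int k - 1) z)"
    using cup_assoc[of X "int i" "int j" "int k - 1" a b z] unfolding e
    by (simp add: coboundary_sign cup_sign_right distrib_left power_add right_diff_distrib
        mult.left_commute[of "(- 1) ^ j"] mult.assoc sign_square)
  show ?thesis
    unfolding massey_vanishes_def
    by (rule exI[of _ m], rule exI[of _ "l + ?l"], rule exI[of _ "w + ?w"])
       (use * c in \<open>simp add: plus_in_cochains coboundary_plus cup_plus_right dl dw flip: *(6)\<close>;
        simp add: algebra_simps)
qed

text \<open>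
  For \<open>b + d y\<close> the cochains become \<open>m + (- 1) ^ i * a \<bullet> y\<close> and \<open>l + y \<bullet> c\<close>.  The two contributions
  \<open>\<plusminus> a \<bullet> y \<bullet> c\<close> to the third product cancel.
\<close>

lemma massey_vanishes_change_middle:
  assumes v: "massey_vanishes X i j k a b c" and y: "y \<in> cochains X (int j - 1)"
    and a: "coboundary X i a = 0" and c: "coboundary X k c = 0"
  shows "massey_vanishes X i j k a (b + coboundary X (int j - 1) y) c"
proof -
  obtain m l w where *: "m \<in> cochains X (int i + int j - 1)" "l \<in> cochains X (int j + int k - 1)"
    "w \<in> cochains X (int i + int j + int k - 2)"
    "coboundary X (int i + int j - 1) m = cup X i j a b"
    "coboundary X (int j + int k - 1) l = cup X j k b c"
    "cup X i (int j + int k - 1) a l + (- 1) ^ (i + 1) * cup X (int i + int j - 1) k m c =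
      coboundary X (int i + int j + int k - 2) w"
    using v unfolding massey_vanishes_def by blast
  let ?m = "(- 1) ^ i * cup X i (int j - 1) a y" and ?l = "cup X (int j - 1) k y c"
  have e: "int i + (int j - 1) = int i + int j - 1" "int j - 1 + int k = int j + int k - 1" by simp_all
  have ml: "?m \<in> cochains X (int i + int j - 1)" "?l \<in> cochains X (int j + int k - 1)"
    using cup_in_cochains[of X "int i" "int j - 1" a y] cup_in_cochains[of X "int j - 1" "int k" y c]
    unfolding e by (auto intro: times_in_cochains)
  have dm: "coboundary X (int i + int j - 1) ?m = cup X i j a (coboundary X (int j - 1) y)"
    using coboundary_cup[of X "int i" "int j - 1" a y] a unfolding e
    by (simp add: coboundary_sign sign_square)
  have dl: "coboundary X (int j + int k - 1) ?l = cup X j k (coboundary X (int j - 1) y) c"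
    using coboundary_cup[of X "int j - 1" "int k" y c] c unfolding e by simp
  have "(- 1) ^ (i + 1) * cup X (int i + int j - 1) k ?m c = - cup X i (int j + int k - 1) a ?l"
    using cup_assoc[of X "int i" "int j - 1" "int k" a y c] unfolding e
    by (simp add: cup_sign_left sign_square)
  then have "cup X i (int j + int k - 1) a (l + ?l) +
      (- 1) ^ (i + 1) * cup X (int i + int j - 1) k (m + ?m) c = coboundary X (int i + int j + int k - 2) w"
    unfolding *(6)[symmetric] by (simp only: cup_plus_left cup_plus_right distrib_left) simp
  then show ?thesis
    unfolding massey_vanishes_def
    by (intro exI[of _ "m + ?m"] exI[of _ "l + ?l"] exI[of _ w])
       (use * ml in \<open>simp add: plus_in_cochains coboundary_plus cup_plus_left cup_plus_right dm dl\<close>)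
qed

section \<open>Cochains that vanish on small simplices\<close>

definition small_simplex :: "'a set set \<Rightarrow> 'a topology \<Rightarrow> nat \<Rightarrow> ((nat \<Rightarrow> real) \<Rightarrow> 'a) \<Rightarrow> bool" where
  "small_simplex \<C> X p \<sigma> \<longleftrightarrow> (\<exists>V\<in>\<C>. singular_simplex p (subtopology X V) \<sigma>)"

definition small_chain :: "'a set set \<Rightarrow> 'a topology \<Rightarrow> nat \<Rightarrow> 'a chain \<Rightarrow> bool" where
  "small_chain \<C> X p x \<longleftrightarrow> (\<forall>\<sigma>\<in>Poly_Mapping.keys x. small_simplex \<C> X p \<sigma>)"

lemma small_simplex_imp_singular_simplex: "small_simplex \<C> X p \<sigma> \<Longrightarrow> singular_simplex p X \<sigma>"
  by (auto simp: small_simplex_def singular_simplex_subtopology)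

lemma small_chain_zero [simp]: "small_chain \<C> X p 0"
  by (simp add: small_chain_def)

lemma small_chain_of: "small_chain \<C> X p (frag_of \<sigma>) \<longleftrightarrow> small_simplex \<C> X p \<sigma>"
  by (simp add: small_chain_def)

lemma small_chain_diff: "small_chain \<C> X p x \<Longrightarrow> small_chain \<C> X p y \<Longrightarrow> small_chain \<C> X p (x - y)"
  unfolding small_chain_def using keys_diff[of x y] by blast

lemma singular_chain_imp_small_chain:
  assumes "V \<in> \<C>" "singular_chain p (subtopology X V) x"
  shows "small_chain \<C> X p x"
  using assms by (auto simp: small_chain_def small_simplex_def singular_chain_def)

lemma small_point:
  assumes "topspace X \<subseteq> \<Union>\<C>" and \<sigma>: "singular_simplex 0 X \<sigma>"
  shows "small_simplex \<C> X 0 \<sigma>"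
proof -
  let ?v = "\<lambda>j::nat. if j = 0 then 1 else 0 :: real"
  have "\<sigma> ?v \<in> topspace X"
    using \<sigma> by (auto simp: singular_simplex_def continuous_map_def standard_simplex_0)
  then obtain V where "V \<in> \<C>" "\<sigma> ?v \<in> V" using assms(1) by blast
  then show ?thesis
    using \<sigma> by (auto simp: small_simplex_def singular_simplex_subtopology standard_simplex_0)
qed

lemma pairing_small_chain:
  assumes "small_chain \<C> X p x" "\<And>\<sigma>. small_simplex \<C> X p \<sigma> \<Longrightarrow> c \<sigma> = 0"
  shows "pairing c x = 0"
  unfolding pairing_def using assms by (auto simp: small_chain_def intro!: sum.neutral)

text \<open>
  Iterated subdivision makes \<open>x\<close> small.  It is chain homotopic to the identity by a natural homotopy,
  which therefore preserves each subspace and hence small chains; so the term that the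
  homotopy contributes for the boundary of \<open>x\<close> is small.
\<close>

lemma small_homologous_chain:
  assumes op: "\<And>V. V \<in> \<C> \<Longrightarrow> openin X V" and cov: "topspace X \<subseteq> \<Union>\<C>"
    and x: "singular_chain p X x" and bd: "small_chain \<C> X (p - 1) (chain_boundary p x)"
  obtains v where "singular_chain (Suc p) X v" "small_chain \<C> X p (x - chain_boundary (Suc p) v)"
proof -
  obtain n where n: "\<And>\<sigma>. \<sigma> \<in> Poly_Mapping.keys ((singular_subdivision p ^^ n) x)
      \<Longrightarrow> \<exists>V\<in>\<C>. \<sigma> \<in> standard_simplex p \<rightarrow> V"
    using sufficient_iterated_singular_subdivision_exists[OF op cov x] by (metis order_refl)
  obtain h where h: "\<And>p. h p 0 = (0 :: 'a chain)" "\<And>p c1 c2. h p (c1 - c2) = h p c1 - h p c2"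
    "\<And>p X c. singular_chain p X c \<Longrightarrow> singular_chain (Suc p) X (h p c)"
    "\<And>p X c. singular_chain p X c \<Longrightarrow> chain_boundary (Suc p) (h p c) + h (p - Suc 0) (chain_boundary p c)
      = (singular_subdivision p ^^ n) c - c"
    by (rule chain_homotopic_iterated_singular_subdivision[of n]) blast
  have "singular_chain p X ((singular_subdivision p ^^ n) x)"
    by (induction n) (simp_all add: x singular_chain_singular_subdivision)
  then have "\<exists>V\<in>\<C>. singular_simplex p (subtopology X V) \<sigma>"
    if "\<sigma> \<in> Poly_Mapping.keys ((singular_subdivision p ^^ n) x)" for \<sigma>
    using n[OF that] that unfolding singular_chain_def singular_simplex_subtopology by blast
  then have sub: "small_chain \<C> X p ((singular_subdivision p ^^ n) x)"
    by (simp add: small_chain_def small_simplex_def)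
  \<comment> \<open>The homotopy \<open>h\<close> exists on all subspaces at once and maps chains of each \<open>V\<close> to chains of \<open>V\<close>.\<close>
  have h_small: "small_chain \<C> X (Suc q) (h q y)" if "small_chain \<C> X q y" for q y
  proof -
    have "Poly_Mapping.keys y \<subseteq> Collect (small_simplex \<C> X q)"
      using that by (auto simp: small_chain_def)
    then show ?thesis
    proof (induction rule: frag_induction)
      case (one \<sigma>)
      then obtain V where "V \<in> \<C>" "singular_chain q (subtopology X V) (frag_of \<sigma>)"
        by (auto simp: small_simplex_def singular_chain_of)
      then show ?case using h(3) singular_chain_imp_small_chain by metis
    qed (simp_all add: h small_chain_diff)
  qed
  have "small_chain \<C> X p (h (p - Suc 0) (chain_boundary p x))"
  proof (cases p)
    case 0
    then show ?thesis by (simp add: chain_boundary_def h)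
  next
    case (Suc q)
    then show ?thesis using h_small[of q] bd by simp
  qed
  moreover have "x - chain_boundary (Suc p) (- h p x) =
      (singular_subdivision p ^^ n) x - h (p - Suc 0) (chain_boundary p x)"
    using h(4)[OF x] by (simp add: chain_boundary_minus algebra_simps)
  moreover have "singular_chain (Suc p) X (- h p x)"
    using h(3)[OF x] by (simp add: singular_chain_minus)
  ultimately show ?thesis
    using that sub small_chain_diff by metis
qed

text \<open>
  A contraction of the complex of all chains modulo the small ones: \<open>D\<close> vanishes on small simplices,
  and \<open>\<sigma> - D (\<partial> \<sigma>) - \<partial> (D \<sigma>)\<close> is small.  In general no iterate of the
  subdivision operator makes all simplices small at once; \<open>D\<close> subdivides each simplex as often as it needs, and
  being defined on all simplices it has a dual on cochains.
\<close>

definition small_contraction :: "'a set set \<Rightarrow> 'a topology \<Rightarrow> (nat \<Rightarrow> ((nat \<Rightarrow> real) \<Rightarrow> 'a) \<Rightarrow> 'a chain) \<Rightarrow> bool" where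
  "small_contraction \<C> X D \<longleftrightarrow> (\<forall>p. (\<forall>\<sigma>. singular_simplex p X \<sigma> \<longrightarrow> singular_chain (Suc p) X (D p \<sigma>)) \<and>
    (\<forall>\<sigma>. small_simplex \<C> X p \<sigma> \<longrightarrow> D p \<sigma> = 0) \<and>
    (\<forall>\<sigma>. singular_simplex (Suc p) X \<sigma> \<longrightarrow> small_chain \<C> X (Suc p) (frag_of \<sigma> -
      frag_extend (D p) (chain_boundary (Suc p) (frag_of \<sigma>)) - chain_boundary (Suc (Suc p)) (D (Suc p) \<sigma>))))"

text \<open>
  Chains are free, so \<open>D\<close> can be chosen on one simplex at a time, by recursion on the dimension.  Given
  \<open>D\<close> in dimension \<open>p\<close>, the chain \<open>\<sigma> - D (\<partial> \<sigma>)\<close> has small boundary, and the preceding lemma provides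
  \<open>D \<sigma>\<close>.  For this step the property \<open>P\<close> records that \<open>x - \<partial> (D x)\<close> is small for every cycle \<open>x\<close>.
\<close>

lemma small_contraction_exists:
  assumes op: "\<And>V. V \<in> \<C> \<Longrightarrow> openin X V" and cov: "topspace X \<subseteq> \<Union>\<C>"
  shows "\<exists>D. small_contraction \<C> X D"
proof -
  define P where "P p D \<longleftrightarrow> (\<forall>\<sigma>. singular_simplex p X \<sigma> \<longrightarrow> singular_chain (Suc p) X (D \<sigma>)) \<and>
      (\<forall>\<sigma>. small_simplex \<C> X p \<sigma> \<longrightarrow> D \<sigma> = 0) \<and>
      (\<forall>x. singular_chain p X x \<and> chain_boundary p x = 0 \<longrightarrow>
         small_chain \<C> X p (x - chain_boundary (Suc p) (frag_extend D x)))"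
    for p and D :: "_ \<Rightarrow> 'a chain"
  define Q where "Q p D D' \<longleftrightarrow> (\<forall>\<sigma>. singular_simplex (Suc p) X \<sigma> \<longrightarrow> small_chain \<C> X (Suc p)
      (frag_of \<sigma> - frag_extend D (chain_boundary (Suc p) (frag_of \<sigma>)) - chain_boundary (Suc (Suc p)) (D' \<sigma>)))"
    for p and D D' :: "_ \<Rightarrow> 'a chain"
  have "\<exists>D. \<forall>p. P p (D p) \<and> Q p (D p) (D (Suc p))"
  proof (rule dependent_nat_choice)
    have "frag_extend (\<lambda>_. 0) x = (0 :: 'a chain)" for x :: "'a chain"
      by (simp add: frag_extend_def)
    then have "P 0 (\<lambda>_. 0)"
      using small_point[OF cov] by (auto simp: P_def small_chain_def singular_chain_def)
    then show "\<exists>D. P 0 D" by (intro exI)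
  next
    fix D p assume "P p D"
    then have D: "\<And>\<sigma>. singular_simplex p X \<sigma> \<Longrightarrow> singular_chain (Suc p) X (D \<sigma>)"
      "\<And>\<sigma>. small_simplex \<C> X p \<sigma> \<Longrightarrow> D \<sigma> = 0"
      "\<And>x. singular_chain p X x \<Longrightarrow> chain_boundary p x = 0 \<Longrightarrow>
        small_chain \<C> X p (x - chain_boundary (Suc p) (frag_extend D x))"
      unfolding P_def by blast+
    have ex: "\<exists>v. singular_chain (Suc (Suc p)) X v \<and> small_chain \<C> X (Suc p)
        (frag_of \<sigma> - frag_extend D (chain_boundary (Suc p) (frag_of \<sigma>)) - chain_boundary (Suc (Suc p)) v) \<and>
        (small_simplex \<C> X (Suc p) \<sigma> \<longrightarrow> v = 0)"
      if \<sigma>: "singular_simplex (Suc p) X \<sigma>" for \<sigma>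
    proof (cases "small_simplex \<C> X (Suc p) \<sigma>")
      case True
      then obtain V where V: "V \<in> \<C>" "singular_simplex (Suc p) (subtopology X V) \<sigma>"
        unfolding small_simplex_def by blast
      have "small_simplex \<C> X p (singular_face (Suc p) k \<sigma>)" if "k \<le> Suc p" for k
        using singular_simplex_singular_face[OF V(2), of k] V(1) that unfolding small_simplex_def by auto
      then have "frag_extend D (chain_boundary (Suc p) (frag_of \<sigma>)) = 0"
        by (simp add: chain_boundary_of frag_extend_sum frag_extend_cmul D(2) del: sum.atMost_Suc)
      then show ?thesis
        using True by (intro exI[of _ 0]) (simp add: small_chain_of)
    next
      case False
      let ?bd = "chain_boundary (Suc p) (frag_of \<sigma>)"
      let ?x = "frag_of \<sigma> - frag_extend D ?bd"
      have bd: "singular_chain p X ?bd"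
        using \<sigma> by (intro singular_chain_boundary_alt) (simp add: singular_chain_of)
      have "chain_boundary p ?bd = 0"
        using chain_boundary_boundary[of "Suc p" X "frag_of \<sigma>"] \<sigma> by (simp add: singular_chain_of)
      then have "small_chain \<C> X (Suc p - 1) (chain_boundary (Suc p) ?x)"
        using D(3)[OF bd] by (simp add: chain_boundary_diff)
      moreover have "singular_chain (Suc p) X ?x"
        using bd D(1) \<sigma> by (intro singular_chain_diff singular_chain_extend)
          (auto simp: singular_chain_of singular_chain_def)
      ultimately obtain v where "singular_chain (Suc (Suc p)) X v"
        "small_chain \<C> X (Suc p) (?x - chain_boundary (Suc (Suc p)) v)"
        using small_homologous_chain[OF op cov] by blast
      then show ?thesis using False by blast
    qed
    define D' where "D' \<sigma> = (if singular_simplex (Suc p) X \<sigma> then SOME v. singular_chain (Suc (Suc p)) X v \<and>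
        small_chain \<C> X (Suc p)
        (frag_of \<sigma> - frag_extend D (chain_boundary (Suc p) (frag_of \<sigma>)) - chain_boundary (Suc (Suc p)) v) \<and>
        (small_simplex \<C> X (Suc p) \<sigma> \<longrightarrow> v = 0) else 0)" for \<sigma>
    have D': "singular_chain (Suc (Suc p)) X (D' \<sigma>)" "small_chain \<C> X (Suc p)
        (frag_of \<sigma> - frag_extend D (chain_boundary (Suc p) (frag_of \<sigma>)) - chain_boundary (Suc (Suc p)) (D' \<sigma>))"
        "small_simplex \<C> X (Suc p) \<sigma> \<Longrightarrow> D' \<sigma> = 0"
      if "singular_simplex (Suc p) X \<sigma>" for \<sigma>
      using someI_ex[OF ex[OF that]] that unfolding D'_def by auto
    have "small_chain \<C> X (Suc p) (x - frag_extend D (chain_boundary (Suc p) x) -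
        chain_boundary (Suc (Suc p)) (frag_extend D' x))"
      if "singular_chain (Suc p) X x" for x
      using that unfolding singular_chain_def
    proof (induction rule: frag_induction)
      case (diff a b)
      then show ?case
        using small_chain_diff[OF diff] by (simp add: chain_boundary_diff frag_extend_diff algebra_simps)
    qed (simp_all add: D')
    then have "small_chain \<C> X (Suc p) (x - chain_boundary (Suc (Suc p)) (frag_extend D' x))"
      if "singular_chain (Suc p) X x" "chain_boundary (Suc p) x = 0" for x
      using that by fastforce
    then have "P (Suc p) D'"
      unfolding P_def using D'(1) D'(3)[OF small_simplex_imp_singular_simplex] by blast
    moreover have "Q p D D'" unfolding Q_def using D'(2) by blast
    ultimately show "\<exists>D'. P (Suc p) D' \<and> Q p D D'" by blast
  qed
  then obtain D where D: "\<And>p. P p (D p)" "\<And>p. Q p (D p) (D (Suc p))" by blast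
  show ?thesis
    using D unfolding P_def Q_def small_contraction_def by (intro exI[of _ D]) simp
qed

text \<open>
  The cochain \<open>m\<close> is the composite of \<open>z\<close> with a contraction \<open>D\<close> modulo small chains.  Evaluating \<open>z\<close> on
  the small chain \<open>\<sigma> - D (\<partial> \<sigma>) - \<partial> (D \<sigma>)\<close> gives \<open>0 = z \<sigma> - d m \<sigma> - d z (D \<sigma>)\<close>, and \<open>d z = 0\<close>.
\<close>

lemma small_cocycle_is_small_coboundary:
  assumes op: "\<And>V. V \<in> \<C> \<Longrightarrow> openin X V" and cov: "topspace X \<subseteq> \<Union>\<C>"
    and z: "z \<in> cocycles X n" and vanish: "\<And>\<sigma>. small_simplex \<C> X (nat n) \<sigma> \<Longrightarrow> z \<sigma> = 0"
  obtains m where "m \<in> cochains X (n - 1)" "coboundary X (n - 1) m = z"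
    "\<And>\<sigma>. small_simplex \<C> X (nat (n - 1)) \<sigma> \<Longrightarrow> m \<sigma> = 0"
proof (cases "n \<le> 0")
  case True
  \<comment> \<open>Every \<open>0\<close>-simplex is small.\<close>
  have "z \<sigma> = 0" if "z \<sigma> \<noteq> 0" for \<sigma>
  proof -
    have "0 \<le> n \<and> singular_simplex (nat n) X \<sigma>"
      using z that unfolding cocycles_def cochains_def by blast
    then show ?thesis using vanish small_point[OF cov] True by simp
  qed
  then have "z = 0" by fastforce
  then show ?thesis using that[of 0] by simp
next
  case False
  define p where "p = nat (n - 1)"
  have n: "n = int (Suc p)" "n - 1 = int p" using False by (simp_all add: p_def)
  obtain D where "small_contraction \<C> X D"
    using small_contraction_exists[OF op cov] by blast
  then have D: "\<And>p \<sigma>. singular_simplex p X \<sigma> \<Longrightarrow> singular_chain (Suc p) X (D p \<sigma>)"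
    "\<And>p \<sigma>. small_simplex \<C> X p \<sigma> \<Longrightarrow> D p \<sigma> = 0"
    "\<And>p \<sigma>. singular_simplex (Suc p) X \<sigma> \<Longrightarrow> small_chain \<C> X (Suc p) (frag_of \<sigma> -
      frag_extend (D p) (chain_boundary (Suc p) (frag_of \<sigma>)) - chain_boundary (Suc (Suc p)) (D (Suc p) \<sigma>))"
    unfolding small_contraction_def by simp_all
  define m where "m \<sigma> = (if singular_simplex p X \<sigma> then pairing z (D p \<sigma>) else 0)" for \<sigma>
  have "coboundary X (int p) m \<sigma> = z \<sigma>" for \<sigma>
  proof (cases "singular_simplex (Suc p) X \<sigma>")
    case True
    let ?bd = "chain_boundary (Suc p) (frag_of \<sigma>)"
    have bd: "singular_chain p X ?bd"
      using True by (intro singular_chain_boundary_alt) (simp add: singular_chain_of)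
    have "coboundary X (int p) m \<sigma> = pairing m ?bd"
      by (rule coboundary_eq_pairing[OF True])
    also have "\<dots> = pairing (\<lambda>\<tau>. pairing z (D p \<tau>)) ?bd"
      using bd by (intro pairing_cong) (auto simp: m_def singular_chain_def)
    also have "\<dots> = pairing z (frag_extend (D p) ?bd)"
      by (simp add: pairing_frag_extend)
    also have "\<dots> = z \<sigma> - pairing z (chain_boundary (Suc (Suc p)) (D (Suc p) \<sigma>))"
    proof -
      have "pairing z (frag_of \<sigma> - frag_extend (D p) ?bd - chain_boundary (Suc (Suc p)) (D (Suc p) \<sigma>)) = 0"
        by (rule pairing_small_chain[OF D(3)[OF True]]) (rule vanish, simp only: n nat_int)
      then show ?thesis
        unfolding pairing_diff pairing_frag_of by (simp add: algebra_simps)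
    qed
    also have "pairing z (chain_boundary (Suc (Suc p)) (D (Suc p) \<sigma>)) =
        pairing (coboundary X (int (Suc p)) z) (D (Suc p) \<sigma>)"
      by (rule pairing_coboundary[symmetric]) (rule D(1)[OF True])
    also have "\<dots> = 0"
      using z unfolding cocycles_def n by (simp add: pairing_def)
    finally show ?thesis by simp
  next
    case False
    then show ?thesis
      using z unfolding cocycles_def cochains_def n by (auto simp: coboundary_def nat_add_distrib)
  qed
  then have "coboundary X (n - 1) m = z" unfolding n by (simp add: fun_eq_iff)
  moreover have "m \<in> cochains X (n - 1)" unfolding n by (simp add: cochains_def m_def)
  moreover have "m \<sigma> = 0" if "small_simplex \<C> X (nat (n - 1)) \<sigma>" for \<sigma>
    using D(2) that unfolding n by (simp add: m_def)
  ultimately show ?thesis using that by blast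
qed

section \<open>Natural lifts in a fibration\<close>

lemma fibration_surjective:
  assumes fib: "fibration E B p" and B: "path_connected_space B" and E: "topspace E \<noteq> {}"
    and b: "b \<in> topspace B"
  shows "\<exists>e\<in>topspace E. p e = b"
proof -
  let ?I = "top_of_set {0..1::real}" and ?Y = "discrete_topology {()}"
  obtain e where e: "e \<in> topspace E" using E by blast
  have "continuous_map E B p" using fib unfolding fibration_def by blast
  then have "p e \<in> topspace B" using e by (auto simp: continuous_map_def)
  then obtain g where g: "pathin B g" "g 0 = p e" "g 1 = b"
    using B b unfolding path_connected_space_def by blast
  have "continuous_map (prod_topology ?I ?Y) B (g \<circ> fst)"
    using g(1) unfolding pathin_def by (intro continuous_map_compose[OF continuous_map_fst])
  moreover have "continuous_map ?Y E (\<lambda>_. e)" using e by simp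
  ultimately obtain G where G: "continuous_map (prod_topology ?I ?Y) E G"
      "\<forall>t\<in>{0..1}. \<forall>y\<in>topspace ?Y. p (G (t, y)) = (g \<circ> fst) (t, y)"
    using fibration_homotopy_lifting[OF fib, of ?Y] g(2) unfolding homotopy_lifting_def
    by (drule_tac x="\<lambda>_. e" in spec, drule_tac x="g \<circ> fst" in spec) auto
  have "G (1, ()) \<in> topspace E"
    using G(1) by (auto simp: continuous_map_def Pi_iff)
  moreover have "p (G (1, ())) = b" using G(2) g(3) by simp
  ultimately show ?thesis by blast
qed

lemma continuous_map_locally:
  assumes "\<And>x. x \<in> topspace X \<Longrightarrow> \<exists>N. openin X N \<and> x \<in> N \<and> continuous_map (subtopology X N) Y f"
  shows "continuous_map X Y f"
  unfolding continuous_map_def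
proof (intro conjI funcsetI allI impI)
  fix x assume "x \<in> topspace X"
  then obtain N where "x \<in> N" "continuous_map (subtopology X N) Y f" using assms by blast
  then show "f x \<in> topspace Y" using \<open>x \<in> topspace X\<close> by (auto simp: continuous_map_def)
next
  fix V assume V: "openin Y V"
  show "openin X {x \<in> topspace X. f x \<in> V}"
  proof (subst openin_subopen, intro ballI)
    fix x assume x: "x \<in> {x \<in> topspace X. f x \<in> V}"
    then obtain N where N: "openin X N" "x \<in> N" "continuous_map (subtopology X N) Y f"
      using assms by blast
    have "openin (subtopology X N) {y \<in> topspace (subtopology X N). f y \<in> V}"
      by (rule openin_continuous_map_preimage[OF N(3) V])
    then have "openin X {y \<in> topspace (subtopology X N). f y \<in> V}"
      using N(1) openin_trans_full by blast
    then show "\<exists>T. openin X T \<and> x \<in> T \<and> T \<subseteq> {x \<in> topspace X. f x \<in> V}"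
      using x N(2) by (intro exI[of _ "{y \<in> topspace (subtopology X N). f y \<in> V}"]) auto
  qed
qed

text \<open>
  A lift of a homotopy can be chosen such that its value at a point depends only on the path that
  the homotopy traces from that point and on the initial value of the lift: the set of these
  pairs of a point of \<open>E\<close> and a path in \<open>B\<close>, with the quotient topology, is itself a test space, and
  a lift is chosen once over it.  This is what makes lifts over different simplices agree
  on common faces.
\<close>

lemma fibration_natural_lift:
  fixes E :: "'e topology" and B :: "'b topology" and X :: "'x topology"
  assumes fib: "fibration E B p" and g: "continuous_map X E g"
    and H: "continuous_map (prod_topology (top_of_set {0..1::real}) X) B H"
    and H0: "\<And>x. x \<in> topspace X \<Longrightarrow> H (0, x) = p (g x)"
  obtains e where "continuous_map X E e" "\<And>x. x \<in> topspace X \<Longrightarrow> p (e x) = H (1, x)"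
    and "\<And>x y. x \<in> topspace X \<Longrightarrow> y \<in> topspace X \<Longrightarrow> g x = g y \<Longrightarrow> (\<And>s. s \<in> {0..1} \<Longrightarrow> H (s, x) = H (s, y)) \<Longrightarrow>
      e x = e y"
proof -
  let ?I = "top_of_set {0..1::real}"
  define q :: "'x \<Rightarrow> 'e \<times> (real \<Rightarrow> 'b)" where "q = (\<lambda>x. (g x, \<lambda>s. if s \<in> {0..1} then H (s, x) else undefined))"
  obtain Q where Q: "quotient_map X Q q" by (rule quotient_topology_exists)
  have tQ: "topspace Q = q ` topspace X" using Q by (simp add: quotient_map_def)
  have "locally_compact_space ?I"
    by (simp add: compact_imp_locally_compact_space compact_space_subtopology)
  moreover have "Hausdorff_space ?I"
    by (simp add: Hausdorff_space_subtopology)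
  ultimately have QI: "quotient_map (prod_topology ?I X) (prod_topology ?I Q) (\<lambda>(s, x). (s, q x))"
    using quotient_map_prod_right Q by blast
  have "continuous_map Q E fst"
    by (rule continuous_compose_quotient_map[OF Q]) (use g in \<open>simp add: q_def comp_def\<close>)
  moreover have "continuous_map (prod_topology ?I Q) B (\<lambda>(s, z). snd z s)"
  proof (rule continuous_compose_quotient_map[OF QI])
    show "continuous_map (prod_topology ?I X) B ((\<lambda>(s, z). snd z s) \<circ> (\<lambda>(s, x). (s, q x)))"
      by (rule continuous_map_eq[OF H]) (auto simp: q_def)
  qed
  moreover have "\<forall>z\<in>topspace Q. snd z 0 = p (fst z)"
    by (auto simp: tQ q_def H0)
  moreover have "homotopy_lifting Q E B p" using fib unfolding fibration_def by blast
  ultimately obtain G where G: "continuous_map (prod_topology ?I Q) E G"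
      "\<forall>s\<in>{0..1}. \<forall>z\<in>topspace Q. p (G (s, z)) = snd z s"
    unfolding homotopy_lifting_def by (drule_tac x=fst in spec, drule_tac x="\<lambda>(s, z). snd z s" in spec) auto
  have "continuous_map X (prod_topology ?I Q) (\<lambda>x. (1, q x))"
    using quotient_imp_continuous_map[OF Q] by (auto simp: continuous_map_paired)
  then have "continuous_map X E (G \<circ> (\<lambda>x. (1, q x)))"
    using G(1) by (rule continuous_map_compose)
  then show ?thesis
  proof (rule that)
    show "p ((G \<circ> (\<lambda>x. (1, q x))) x) = H (1, x)" if "x \<in> topspace X" for x
      using G(2) that by (auto simp: tQ q_def)
    show "(G \<circ> (\<lambda>x. (1, q x))) x = (G \<circ> (\<lambda>x. (1, q x))) y"
      if "g x = g y" "\<And>s. s \<in> {0..1} \<Longrightarrow> H (s, x) = H (s, y)" for x y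
    proof -
      have "q x = q y" using that unfolding q_def by (auto simp: fun_eq_iff)
      then show ?thesis by simp
    qed
  qed
qed

section \<open>Vertices with dominating barycentric coordinates\<close>

text \<open>
  The index \<open>b\<close> ranges over all natural numbers, also beyond the dimension of the simplex in
  which \<open>t\<close> lies.  This forces the coordinates in \<open>S\<close> to be positive and makes the condition invariant
  under face inclusions.
\<close>

definition dominates :: "nat set \<Rightarrow> (nat \<Rightarrow> real) \<Rightarrow> bool" where
  "dominates S t \<longleftrightarrow> finite S \<and> S \<noteq> {} \<and> (\<forall>a\<in>S. \<forall>b. b \<notin> S \<longrightarrow> t b < t a)"

definition top_vertices :: "nat \<Rightarrow> (nat \<Rightarrow> real) \<Rightarrow> nat set" where
  "top_vertices i t = (THE S. dominates S t \<and> card S = Suc i)"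

definition barycentre :: "nat set \<Rightarrow> nat \<Rightarrow> real" where
  "barycentre S = (\<lambda>i. if i \<in> S then 1 / real (card S) else 0)"

text \<open>
  The disjoint union of the standard simplices indexed by the singular simplices of \<open>B\<close> of dimension
  at most \<open>n\<close>.  The dimension is part of the index because the function alone need not determine it.
\<close>

definition simplex_space :: "'b topology \<Rightarrow> nat \<Rightarrow> ((nat \<times> ((nat \<Rightarrow> real) \<Rightarrow> 'b)) \<times> (nat \<Rightarrow> real)) topology" where
  "simplex_space B n = subtopology (prod_topology (discrete_topology UNIV) (powertop_real UNIV))
     {((m, \<sigma>), t). m \<le> n \<and> singular_simplex m B \<sigma> \<and> t \<in> standard_simplex m}"

lemma topspace_simplex_space:
  "topspace (simplex_space B n) = {((m, \<sigma>), t). m \<le> n \<and> singular_simplex m B \<sigma> \<and> t \<in> standard_simplex m}"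
  by (auto simp: simplex_space_def)

lemma dominates_unique:
  assumes "dominates S t" "dominates T t" "card S = card T"
  shows "S = T"
proof (rule ccontr)
  assume "S \<noteq> T"
  have fin: "finite S" "finite T" using assms unfolding dominates_def by auto
  then have "\<not> S \<subseteq> T" "\<not> T \<subseteq> S"
    using \<open>S \<noteq> T\<close> assms(3) card_subset_eq by (metis, metis)
  then obtain a b where "a \<in> S" "a \<notin> T" "b \<in> T" "b \<notin> S" by blast
  then have "t b < t a" "t a < t b" using assms unfolding dominates_def by blast+
  then show False by simp
qed

lemma top_vertices_eq:
  assumes "dominates S t" "card S = Suc i"
  shows "top_vertices i t = S"
  unfolding top_vertices_def using assms by (intro the_equality) (auto dest: dominates_unique)

lemma dominates_positive:
  assumes S: "dominates S t" and t: "t \<in> standard_simplex m" and a: "a \<in> S"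
  shows "0 < t a"
proof -
  obtain b where "b \<notin> S" using S infinite_UNIV_nat unfolding dominates_def by (metis ex_new_if_finite)
  then have "t b < t a" using S a unfolding dominates_def by blast
  moreover have "0 \<le> t b" using t by (simp add: standard_simplex_def)
  ultimately show ?thesis by simp
qed

lemma dominates_subset:
  assumes "dominates S t" "t \<in> standard_simplex m"
  shows "S \<subseteq> {..m}"
proof
  fix a assume "a \<in> S"
  then have "t a \<noteq> 0" using dominates_positive[OF assms] by fastforce
  then show "a \<in> {..m}" using assms(2) by (auto simp: standard_simplex_def not_less[symmetric])
qed

text \<open>
  The set of vertices with positive coordinate always dominates.  Hence the conditions \<open>card S = Suc i\<close>
  for \<open>i = 0, \<dots>, m\<close> define a cover of the \<open>m\<close>-simplex.
\<close>

lemma dominates_support: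
  assumes "t \<in> standard_simplex m"
  obtains i S where "i \<le> m" "dominates S t" "card S = Suc i"
proof
  let ?S = "{a. 0 < t a}"
  have t: "\<And>a. 0 \<le> t a" "\<And>a. a > m \<Longrightarrow> t a = 0" "sum t {..m} = 1"
    using assms by (auto simp: standard_simplex_def)
  have sub: "?S \<subseteq> {..m}" using t(2) by (force simp: not_le[symmetric])
  then have fin: "finite ?S" using finite_subset by blast
  have ne: "?S \<noteq> {}"
  proof
    assume "?S = {}"
    then have "\<not> 0 < t a" for a by blast
    then have "t a = 0" for a using t(1)[of a] by (simp add: order_antisym not_less)
    then show False using t(3) by simp
  qed
  show "dominates ?S t"
    unfolding dominates_def using fin ne t(1) by (auto simp: not_less intro: le_less_trans)
  show "card ?S = Suc (card ?S - 1)"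
    using fin ne by (simp add: card_gt_0_iff)
  show "card ?S - 1 \<le> m"
    using card_mono[OF _ sub] by simp
qed

lemma barycentre_in_standard_simplex:
  assumes "S \<subseteq> {..m}" "S \<noteq> {}"
  shows "barycentre S \<in> standard_simplex m"
proof -
  have "finite S" using assms(1) finite_subset by blast
  then have "card S > 0" using assms(2) by (simp add: card_gt_0_iff)
  have "(\<Sum>i\<le>m. barycentre S i) = (\<Sum>i\<in>S. 1 / real (card S))"
    unfolding barycentre_def by (rule sum.mono_neutral_cong_right) (use assms in auto)
  also have "\<dots> = 1" using \<open>card S > 0\<close> by simp
  finally have "(\<Sum>i\<le>m. barycentre S i) = 1" .
  moreover have "0 \<le> barycentre S i \<and> barycentre S i \<le> 1" for i
    using \<open>card S > 0\<close> by (simp add: barycentre_def)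
  moreover have "barycentre S i = 0" if "i > m" for i
  proof -
    have "i \<notin> S" using assms(1) that by auto
    then show ?thesis by (simp add: barycentre_def)
  qed
  ultimately show ?thesis
    unfolding standard_simplex_def by simp
qed

lemma openin_all_finite:
  assumes "finite K" "\<And>k. k \<in> K \<Longrightarrow> openin X {x \<in> topspace X. P k x}"
  shows "openin X {x \<in> topspace X. \<forall>k\<in>K. P k x}"
  using assms
proof (induction K)
  case (insert k K)
  have "{x \<in> topspace X. \<forall>k\<in>insert k K. P k x} =
      {x \<in> topspace X. P k x} \<inter> {x \<in> topspace X. \<forall>k\<in>K. P k x}" by auto
  then show ?case using insert by (simp add: openin_Int)
qed simp

lemma continuous_map_simplex_space_coordinate:
  "continuous_map (simplex_space B n) euclideanreal (\<lambda>x. snd x i)"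
proof -
  have "continuous_map (simplex_space B n) (powertop_real UNIV) snd"
    unfolding simplex_space_def by (intro continuous_map_from_subtopology continuous_map_snd)
  then show ?thesis by (simp add: continuous_map_componentwise_UNIV)
qed

text \<open>
  On an \<open>m\<close>-simplex all coordinates beyond \<open>m\<close> are zero.  Comparing with the indices up to \<open>Suc m\<close>
  therefore suffices, which leaves finitely many open conditions.
\<close>

lemma openin_simplex_space_dominates:
  "openin (simplex_space B n) {x \<in> topspace (simplex_space B n). fst x = (m, \<sigma>) \<and> dominates S (snd x)}"
proof (cases "finite S \<and> S \<noteq> {} \<and> S \<subseteq> {..m}")
  case True
  then have "S \<subseteq> {..m}" by blast
  let ?X = "simplex_space B n"
  have "openin ?X {x \<in> topspace ?X. 0 < snd x a - snd x b}" for a b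
    using openin_continuous_map_preimage[OF continuous_map_diff[OF
          continuous_map_simplex_space_coordinate continuous_map_simplex_space_coordinate], of "{0<..}" B n a b]
    by simp
  then have lt: "openin ?X {x \<in> topspace ?X. \<forall>k\<in>S \<times> ({..Suc m} - S). snd x (snd k) < snd x (fst k)}"
    using True by (intro openin_all_finite) auto
  have "continuous_map ?X (discrete_topology UNIV) fst"
    unfolding simplex_space_def by (intro continuous_map_from_subtopology continuous_map_fst)
  from openin_continuous_map_preimage[OF this, of "{(m, \<sigma>)}"]
  have index: "openin ?X {x \<in> topspace ?X. fst x = (m, \<sigma>)}" by simp
  have "dominates S t \<longleftrightarrow> (\<forall>k\<in>S \<times> ({..Suc m} - S). t (snd k) < t (fst k))"
    if t: "t \<in> standard_simplex m" for t
  proof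
    assume *: "\<forall>k\<in>S \<times> ({..Suc m} - S). t (snd k) < t (fst k)"
    have "t b < t a" if "a \<in> S" "b \<notin> S" for a b
    proof (cases "b \<le> Suc m")
      case True
      then have "(a, b) \<in> S \<times> ({..Suc m} - S)" using that by simp
      from bspec[OF * this] show ?thesis by simp
    next
      case False
      then have tb: "t b = t (Suc m)" using t by (simp add: standard_simplex_def)
      have "Suc m \<notin> S" using \<open>S \<subseteq> {..m}\<close> by (metis atMost_iff not_less_eq_eq order_refl subsetD)
      then have "(a, Suc m) \<in> S \<times> ({..Suc m} - S)" using that(1) by simp
      from bspec[OF * this] have "t (Suc m) < t a" by simp
      then show ?thesis using tb by simp
    qed
    then show "dominates S t" using True unfolding dominates_def by blast
  qed (auto simp: dominates_def)
  then have eq: "{x \<in> topspace ?X. fst x = (m, \<sigma>) \<and> dominates S (snd x)} =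
      {x \<in> topspace ?X. fst x = (m, \<sigma>)} \<inter>
      {x \<in> topspace ?X. \<forall>k\<in>S \<times> ({..Suc m} - S). snd x (snd k) < snd x (fst k)}"
    by (auto simp: topspace_simplex_space)
  show ?thesis unfolding eq by (rule openin_Int[OF index lt])
next
  case False
  then have "\<not> dominates S t" if "t \<in> standard_simplex m" for t
    using dominates_subset[OF _ that, of S] unfolding dominates_def by blast
  then have eq: "{x \<in> topspace (simplex_space B n). fst x = (m, \<sigma>) \<and> dominates S (snd x)} = {}"
    by (auto simp: topspace_simplex_space)
  show ?thesis unfolding eq by simp
qed

section \<open>The open sets of dominated points\<close>

definition evaluation :: "(nat \<times> ((nat \<Rightarrow> real) \<Rightarrow> 'b)) \<times> (nat \<Rightarrow> real) \<Rightarrow> 'b" where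
  "evaluation x = snd (fst x) (snd x)"

definition dominated_set :: "'b topology \<Rightarrow> nat \<Rightarrow> nat \<Rightarrow> ((nat \<times> ((nat \<Rightarrow> real) \<Rightarrow> 'b)) \<times> (nat \<Rightarrow> real)) set" where
  "dominated_set B n i = {x \<in> topspace (simplex_space B n). \<exists>S. dominates S (snd x) \<and> card S = Suc i}"

text \<open>
  The image in \<open>B\<close> of the straight path from the barycentre of the face spanned by the \<open>i + 1\<close>
  dominating vertices to the point itself.
\<close>

definition from_barycentre :: "nat \<Rightarrow> real \<times> (nat \<times> ((nat \<Rightarrow> real) \<Rightarrow> 'b)) \<times> (nat \<Rightarrow> real) \<Rightarrow> 'b" where
  "from_barycentre i = (\<lambda>(s, (m, \<sigma>), t). \<sigma> (\<lambda>a. (1 - s) * barycentre (top_vertices i t) a + s * t a))"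

lemma openin_dominated_set: "openin (simplex_space B n) (dominated_set B n i)"
proof -
  have eq: "dominated_set B n i = (\<Union>k\<in>{k. card (snd k) = Suc i}.
      {x \<in> topspace (simplex_space B n). fst x = (fst (fst k), snd (fst k)) \<and> dominates (snd k) (snd x)})"
    by (auto simp: dominated_set_def)
  show ?thesis
    unfolding eq by (rule openin_Union) (auto simp only: openin_simplex_space_dominates)
qed

lemma continuous_map_evaluation: "continuous_map (simplex_space B n) B evaluation"
proof (rule continuous_map_locally)
  let ?X = "simplex_space B n"
  fix x assume x: "x \<in> topspace ?X"
  obtain m \<sigma> t where xe: "x = ((m, \<sigma>), t)" by (metis surj_pair)
  have \<sigma>: "singular_simplex m B \<sigma>" using x by (simp add: xe topspace_simplex_space)
  let ?N = "{x \<in> topspace ?X. fst x = (m, \<sigma>)}"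
  have "continuous_map ?X (discrete_topology UNIV) fst"
    unfolding simplex_space_def by (intro continuous_map_from_subtopology continuous_map_fst)
  from openin_continuous_map_preimage[OF this, of "{(m, \<sigma>)}"]
  have "openin ?X ?N" by simp
  moreover have "x \<in> ?N" using x by (simp add: xe)
  moreover have "continuous_map (subtopology ?X ?N) B evaluation"
  proof (rule continuous_map_eq)
    have "continuous_map ?X (powertop_real UNIV) snd"
      unfolding simplex_space_def by (intro continuous_map_from_subtopology continuous_map_snd)
    then have "continuous_map (subtopology ?X ?N) (subtopology (powertop_real UNIV) (standard_simplex m)) snd"
      by (auto simp: continuous_map_in_subtopology topspace_simplex_space continuous_map_from_subtopology)
    then show "continuous_map (subtopology ?X ?N) B (\<sigma> \<circ> snd)"
      using \<sigma> continuous_map_compose unfolding singular_simplex_def by blast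
  qed (auto simp: evaluation_def)
  ultimately show "\<exists>N. openin ?X N \<and> x \<in> N \<and> continuous_map (subtopology ?X N) B evaluation" by blast
qed

lemma continuous_map_from_barycentre:
  "continuous_map (prod_topology (top_of_set {0..1}) (subtopology (simplex_space B n) (dominated_set B n i)))
     B (from_barycentre i)"
proof (rule continuous_map_locally)
  let ?X = "simplex_space B n" and ?I = "top_of_set {0..1::real}"
  let ?W = "prod_topology ?I (subtopology ?X (dominated_set B n i))"
  fix z assume z: "z \<in> topspace ?W"
  obtain s m \<sigma> t where ze: "z = (s, (m, \<sigma>), t)" by (metis surj_pair)
  have x: "((m, \<sigma>), t) \<in> topspace ?X" and s: "s \<in> {0..1}" and "((m, \<sigma>), t) \<in> dominated_set B n i"
    using z by (auto simp: ze)
  then obtain S where S: "dominates S t" "card S = Suc i" by (auto simp: dominated_set_def)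
  have \<sigma>: "singular_simplex m B \<sigma>" and t: "t \<in> standard_simplex m"
    using x by (auto simp: topspace_simplex_space)
  have b: "barycentre S \<in> standard_simplex m"
    using barycentre_in_standard_simplex dominates_subset[OF S(1) t] S(1) unfolding dominates_def by blast
  let ?M = "{x \<in> topspace ?X. fst x = (m, \<sigma>) \<and> dominates S (snd x)}"
  let ?N = "{0..1} \<times> ?M"
  have "?M \<subseteq> dominated_set B n i" using S(2) by (auto simp: dominated_set_def)
  then have "openin (subtopology ?X (dominated_set B n i)) ?M"
    using openin_open_subtopology[OF openin_dominated_set] openin_simplex_space_dominates by blast
  then have "openin ?W ?N"
    by (simp add: openin_prod_Times_iff)
  moreover have "z \<in> ?N" using x s S(1) by (simp add: ze)
  moreover have "continuous_map (subtopology ?W ?N) B (from_barycentre i)"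
  proof (rule continuous_map_eq)
    let ?h = "\<lambda>z a. (1 - fst z) * barycentre S a + fst z * snd (snd z) a"
    have "continuous_map ?W ?I fst" by (rule continuous_map_fst)
    then have "continuous_map ?W euclideanreal fst" using continuous_map_into_fulltopology by blast
    moreover have "continuous_map ?W euclideanreal (\<lambda>z. snd (snd z) a)" for a
      using continuous_map_compose[OF continuous_map_snd continuous_map_from_subtopology[OF
            continuous_map_simplex_space_coordinate[of B n a]]] by (simp add: comp_def)
    ultimately have "continuous_map ?W euclideanreal (\<lambda>z. ?h z a)" for a
      by (intro continuous_intros) auto
    then have "continuous_map (subtopology ?W ?N) (powertop_real UNIV) ?h"
      by (simp add: continuous_map_componentwise_UNIV continuous_map_from_subtopology)
    moreover have "?h z \<in> standard_simplex m" if "z \<in> topspace (subtopology ?W ?N)" for z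
      using that b by (intro convex_standard_simplex) (auto simp: topspace_simplex_space)
    ultimately have "continuous_map (subtopology ?W ?N)
        (subtopology (powertop_real UNIV) (standard_simplex m)) ?h"
      by (auto simp: continuous_map_in_subtopology)
    then show "continuous_map (subtopology ?W ?N) B (\<sigma> \<circ> ?h)"
      using \<sigma> continuous_map_compose unfolding singular_simplex_def by blast
    show "(\<sigma> \<circ> ?h) z = from_barycentre i z" if "z \<in> topspace (subtopology ?W ?N)" for z
      using that top_vertices_eq[OF _ S(2)] by (auto simp: from_barycentre_def)
  qed
  ultimately show "\<exists>N. openin ?W N \<and> z \<in> N \<and> continuous_map (subtopology ?W N) B (from_barycentre i)"
    by blast
qed

text \<open>
  On the set of points that have \<open>i + 1\<close> dominating vertices, the straight paths from the
  barycentres deform a locally constant map into the evaluation map.  A locally constant map into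
  \<open>B\<close> has a lift to \<open>E\<close>, and homotopy lifting turns it into a lift of the evaluation map.  The last
  conjunct is the naturality of \<open>fibration_natural_lift\<close>.
\<close>

lemma dominated_set_lift:
  fixes E :: "'e topology" and B :: "'b topology"
  assumes fib: "fibration E B p" and B: "path_connected_space B" and E: "topspace E \<noteq> {}"
  shows "\<exists>e. continuous_map (subtopology (simplex_space B n) (dominated_set B n i)) E e \<and>
    (\<forall>x\<in>dominated_set B n i. p (e x) = evaluation x) \<and>
    (\<forall>x\<in>dominated_set B n i. \<forall>y\<in>dominated_set B n i.
       (\<forall>s\<in>{0..1}. from_barycentre i (s, x) = from_barycentre i (s, y)) \<longrightarrow> e x = e y)"
proof -
  let ?X = "simplex_space B n" and ?I = "top_of_set {0..1::real}"
  let ?XD = "subtopology ?X (dominated_set B n i)"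
  define sel where "sel b = (SOME e. e \<in> topspace E \<and> p e = b)" for b
  have sel: "sel b \<in> topspace E" "p (sel b) = b" if "b \<in> topspace B" for b
    using someI_ex[of "\<lambda>e. e \<in> topspace E \<and> p e = b"] fibration_surjective[OF fib B E that]
    unfolding sel_def by blast+
  have tD: "topspace ?XD = dominated_set B n i" by (auto simp: dominated_set_def)
  \<comment> \<open>The lift of the initial value depends on that value only, as naturality in the path requires.\<close>
  define g where "g x = sel (from_barycentre i (0, x))" for x
  have H: "continuous_map (prod_topology ?I ?XD) B (from_barycentre i)"
    by (rule continuous_map_from_barycentre)
  have inB: "from_barycentre i (0, x) \<in> topspace B" if "x \<in> dominated_set B n i" for x
    using H that tD by (force simp: continuous_map_def Pi_iff)
  have g: "continuous_map ?XD E g"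
  proof (rule continuous_map_locally)
    fix x assume x: "x \<in> topspace ?XD"
    obtain m \<sigma> t where xe: "x = ((m, \<sigma>), t)" by (metis surj_pair)
    obtain S where S: "dominates S t" "card S = Suc i" using x xe by (auto simp: dominated_set_def)
    let ?M = "{x \<in> topspace ?X. fst x = (m, \<sigma>) \<and> dominates S (snd x)}"
    have "?M \<subseteq> dominated_set B n i" using S(2) by (auto simp: dominated_set_def)
    then have "openin ?XD ?M"
      using openin_open_subtopology[OF openin_dominated_set] openin_simplex_space_dominates by blast
    moreover have "x \<in> ?M" using x S(1) by (simp add: xe)
    moreover have "continuous_map (subtopology ?XD ?M) E g"
    proof (rule continuous_map_eq)
      show "continuous_map (subtopology ?XD ?M) E (\<lambda>_. g x)"
        using sel(1) inB x by (simp add: g_def tD)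
      show "g x = g y" if "y \<in> topspace (subtopology ?XD ?M)" for y
        using that top_vertices_eq[OF _ S(2)] S(1)
        by (cases y) (auto simp: g_def from_barycentre_def xe)
    qed
    ultimately show "\<exists>N. openin ?XD N \<and> x \<in> N \<and> continuous_map (subtopology ?XD N) E g" by blast
  qed
  have "from_barycentre i (0, x) = p (g x)" if "x \<in> topspace ?XD" for x
    using sel(2)[OF inB] that unfolding tD g_def by simp
  from fibration_natural_lift[OF fib g H this] obtain e where e: "continuous_map ?XD E e"
    "\<And>x. x \<in> topspace ?XD \<Longrightarrow> p (e x) = from_barycentre i (1, x)"
    "\<And>x y. x \<in> topspace ?XD \<Longrightarrow> y \<in> topspace ?XD \<Longrightarrow> g x = g y \<Longrightarrow>
      (\<And>s. s \<in> {0..1} \<Longrightarrow> from_barycentre i (s, x) = from_barycentre i (s, y)) \<Longrightarrow> e x = e y"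
    by metis
  have "e x = e y" if "x \<in> dominated_set B n i" "y \<in> dominated_set B n i"
      "\<forall>s\<in>{0..1}. from_barycentre i (s, x) = from_barycentre i (s, y)" for x y
    using e(3)[of x y] that unfolding tD by (simp add: g_def)
  moreover have "p (e x) = evaluation x" if "x \<in> dominated_set B n i" for x
    using e(2)[of x] that unfolding tD by (simp add: from_barycentre_def evaluation_def case_prod_unfold)
  ultimately show ?thesis using e(1) by blast
qed

text \<open>
  The map on vertices that underlies the face inclusion \<open>simplical_face k\<close>.
\<close>

definition coface :: "nat \<Rightarrow> nat \<Rightarrow> nat" where
  "coface k a = (if a < k then a else Suc a)"

lemma inj_coface: "inj (coface k)"
  by (auto simp: inj_def coface_def split: if_splits)

lemma simplical_face_coface: "simplical_face k t (coface k a) = t a"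
  by (simp add: simplical_face_def coface_def)

lemma dominates_simplical_face:
  assumes t: "t \<in> standard_simplex m"
  shows "dominates T (simplical_face k t) \<longleftrightarrow>
    (\<exists>S. T = coface k ` S \<and> dominates S t)"
proof -
  note face = simplical_face_coface[of k t]
  have face_k: "simplical_face k t k = 0" by (simp add: simplical_face_def)
  have range: "\<exists>a. b = coface k a" if "b \<noteq> k" for b
  proof (cases "b < k")
    case True
    then show ?thesis by (intro exI[of _ b]) (simp add: coface_def)
  next
    case False
    then show ?thesis using that by (intro exI[of _ "b - 1"]) (simp add: coface_def)
  qed
  show ?thesis
  proof
    assume T: "dominates T (simplical_face k t)"
    then obtain b where b: "b \<notin> T" unfolding dominates_def by (metis ex_new_if_finite infinite_UNIV_nat)
    have "0 \<le> simplical_face k t b" using t by (auto simp: simplical_face_def standard_simplex_def)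
    then have "k \<notin> T" using T b face_k unfolding dominates_def by force
    then have "b \<in> range (coface k)" if "b \<in> T" for b using range[of b] that by blast
    then have TS: "T = coface k ` (coface k -` T)" unfolding image_vimage_eq by blast
    have "dominates (coface k -` T) t"
      unfolding dominates_def
    proof (intro conjI ballI allI impI)
      show "finite (coface k -` T)" using T inj_coface finite_vimageI unfolding dominates_def by blast
      show "coface k -` T \<noteq> {}" using T TS unfolding dominates_def by blast
      show "t b < t a" if "a \<in> coface k -` T" "b \<notin> coface k -` T" for a b
      proof -
        have "simplical_face k t (coface k b) < simplical_face k t (coface k a)"
          using T that unfolding dominates_def by blast
        then show ?thesis by (simp only: face)
      qed
    qed
    then show "\<exists>S. T = coface k ` S \<and> dominates S t" using TS by blast
  next
    assume "\<exists>S. T = coface k ` S \<and> dominates S t"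
    then obtain S where S: "T = coface k ` S" "dominates S t" by blast
    show "dominates T (simplical_face k t)"
      unfolding dominates_def
    proof (intro conjI ballI allI impI)
      show "finite T" "T \<noteq> {}" using S unfolding dominates_def by auto
      fix a' b assume "a' \<in> T" and b: "b \<notin> T"
      then obtain a where a: "a \<in> S" "a' = coface k a" using S(1) by blast
      show "simplical_face k t b < simplical_face k t a'"
      proof (cases "b = k")
        case True
        then show ?thesis using dominates_positive[OF S(2) t a(1)] face face_k a(2) by simp
      next
        case False
        then obtain c where c: "b = coface k c" using range by blast
        then have "c \<notin> S" using b S(1) by blast
        then show ?thesis using S(2) a face c unfolding dominates_def by simp
      qed
    qed
  qed
qed

text \<open>
  The point \<open>x\<close> of the simplex \<open>\<sigma>\<close> and the point \<open>y\<close> of its \<open>k\<close>-th face are to be identified in the geometric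
  realization.  The face inclusion is affine and maps dominating vertices to dominating vertices,
  so the paths from the barycentres to \<open>x\<close> and to \<open>y\<close> have the same image in \<open>B\<close>.
\<close>

lemma face_in_dominated_set:
  assumes \<sigma>: "singular_simplex (Suc m) B \<sigma>" and m: "Suc m \<le> n" and k: "k \<le> Suc m"
    and t: "t \<in> standard_simplex m"
  defines "x \<equiv> ((Suc m, \<sigma>), simplical_face k t)" and "y \<equiv> ((m, singular_face (Suc m) k \<sigma>), t)"
  shows "x \<in> dominated_set B n i \<longleftrightarrow> y \<in> dominated_set B n i"
    and "x \<in> dominated_set B n i \<Longrightarrow> s \<in> {0..1} \<Longrightarrow> from_barycentre i (s, x) = from_barycentre i (s, y)"
    and "evaluation x = evaluation y"
proof -
  have card: "card (coface k ` S) = card S" for S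
    by (intro card_image) (blast intro: inj_on_subset[OF inj_coface])
  have ft: "simplical_face k t \<in> standard_simplex (Suc m)"
    using simplical_face_in_standard_simplex[of "Suc m" k t] k t by simp
  have fs: "singular_simplex m B (singular_face (Suc m) k \<sigma>)"
    using singular_simplex_singular_face[OF \<sigma>, of k] k by simp
  show iff: "x \<in> dominated_set B n i \<longleftrightarrow> y \<in> dominated_set B n i"
    using \<sigma> m t ft fs card dominates_simplical_face[OF t]
    by (auto simp: dominated_set_def x_def y_def topspace_simplex_space)
  show "evaluation x = evaluation y"
    using t by (simp add: evaluation_def x_def y_def singular_face_def)
  show "from_barycentre i (s, x) = from_barycentre i (s, y)" if "x \<in> dominated_set B n i" "s \<in> {0..1}"
  proof -
    have "\<exists>S. dominates S (snd y) \<and> card S = Suc i"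
      using that(1) iff unfolding dominated_set_def by blast
    then obtain S where S: "dominates S t" "card S = Suc i"
      unfolding y_def snd_conv by blast
    have "dominates (coface k ` S) (simplical_face k t)" using S(1) dominates_simplical_face[OF t] by blast
    then have top: "top_vertices i (simplical_face k t) = coface k ` S" "top_vertices i t = S"
      using S card top_vertices_eq by auto
    have "barycentre (coface k ` S) = simplical_face k (barycentre S)"
    proof
      fix a
      have "a \<in> coface k ` S \<longleftrightarrow> a \<noteq> k \<and> (if a < k then a else a - 1) \<in> S"
        by (cases a) (auto simp: coface_def image_iff split: if_splits)
      then show "barycentre (coface k ` S) a = simplical_face k (barycentre S) a"
        by (auto simp: barycentre_def simplical_face_def card)
    qed
    then have "(\<lambda>a. (1 - s) * barycentre (coface k ` S) a + s * simplical_face k t a) =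
        simplical_face k (\<lambda>a. (1 - s) * barycentre S a + s * t a)"
      by (auto simp: simplical_face_def)
    moreover have "(\<lambda>a. (1 - s) * barycentre S a + s * t a) \<in> standard_simplex m"
      using that(2) t barycentre_in_standard_simplex dominates_subset[OF S(1) t] S(1)
      by (intro convex_standard_simplex) (auto simp: dominates_def)
    ultimately show ?thesis
      by (simp add: from_barycentre_def x_def y_def top singular_face_def)
  qed
qed

section \<open>Non-zero classes have finite weight\<close>

text \<open>
  The test space \<open>Q\<close> is a quotient of the disjoint union of all singular simplices of \<open>B\<close> of dimension
  at most \<open>n\<close>: two points become equal if they have the same image in \<open>B\<close>, lie in the same sets
  \<open>dominated_set B n i\<close> and have the same lifts there.  By construction the map \<open>fst\<close> to \<open>B\<close> and the
  \<open>n + 1\<close> lifts descend to \<open>Q\<close>, so the pull-back of the fibration has genus at most \<open>n + 1\<close>, and by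
  the hypothesis on its weight \<open>u\<close> vanishes on \<open>Q\<close>.  Because the lifts are natural, points that
  correspond to each other under a face inclusion become equal in \<open>Q\<close>.  Therefore each simplex \<open>\<sigma>\<close> of
  \<open>B\<close> lifts to a simplex \<open>\<kappa> \<sigma>\<close> of \<open>Q\<close> compatibly with faces, and composing with \<open>\<kappa>\<close> turns an equation
  \<open>fst\<^sup>* c = d b\<close> on \<open>Q\<close> into an equation \<open>c = d b'\<close> on \<open>B\<close>.
\<close>

lemma weight_gt_degree_imp_zero:
  fixes E :: "'e topology" and B :: "'b topology" and u :: "('b, 'r::comm_ring_1) cochain set"
  assumes fib: "fibration E B p" and B: "path_connected_space B" and E: "topspace E \<noteq> {}"
    and u: "u \<in> cohomology B (int n)" and w: "enat (Suc n) \<le> weight E B p (int n) u"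
  shows "u = cohomology_zero B (int n)"
proof -
  let ?X = "simplex_space B n" and ?D = "dominated_set B n"
  have "\<forall>i. \<exists>e. continuous_map (subtopology ?X (?D i)) E e \<and> (\<forall>x\<in>?D i. p (e x) = evaluation x) \<and>
      (\<forall>x\<in>?D i. \<forall>y\<in>?D i. (\<forall>s\<in>{0..1}. from_barycentre i (s, x) = from_barycentre i (s, y)) \<longrightarrow> e x = e y)"
    using dominated_set_lift[OF fib B E] by blast
  then obtain e where "\<forall>i. continuous_map (subtopology ?X (?D i)) E (e i) \<and>
      (\<forall>x\<in>?D i. p (e i x) = evaluation x) \<and>
      (\<forall>x\<in>?D i. \<forall>y\<in>?D i. (\<forall>s\<in>{0..1}. from_barycentre i (s, x) = from_barycentre i (s, y)) \<longrightarrow> e i x = e i y)"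
    by (rule choice[THEN exE])
  then have e: "\<And>i. continuous_map (subtopology ?X (?D i)) E (e i)"
    "\<And>i x. x \<in> ?D i \<Longrightarrow> p (e i x) = evaluation x"
    "\<And>i x y. x \<in> ?D i \<Longrightarrow> y \<in> ?D i \<Longrightarrow>
      (\<forall>s\<in>{0..1}. from_barycentre i (s, x) = from_barycentre i (s, y)) \<Longrightarrow> e i x = e i y"
    by blast+
  define q :: "_ \<Rightarrow> 'b \<times> (nat \<Rightarrow> 'e option)" where
    "q x = (evaluation x, \<lambda>i. if i < Suc n \<and> x \<in> ?D i then Some (e i x) else None)" for x
  obtain Q where Q: "quotient_map ?X Q q" by (rule quotient_topology_exists)
  have tQ: "topspace Q = q ` topspace ?X" using Q by (simp add: quotient_map_def)
  have cQ: "continuous_map Q B fst"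
    by (rule continuous_compose_quotient_map[OF Q])
       (use continuous_map_evaluation in \<open>simp add: q_def comp_def\<close>)
  define V where "V i = {z \<in> topspace Q. snd z i \<noteq> None}" for i
  have pre: "{x \<in> topspace ?X. q x \<in> V i} = ?D i" if "i < Suc n" for i
    using that by (auto simp: V_def tQ q_def dominated_set_def split: if_splits)
  have V: "openin Q (V i)" if "i < Suc n" for i
  proof -
    have "V i \<subseteq> topspace Q" by (auto simp: V_def)
    moreover have "openin ?X {x \<in> topspace ?X. q x \<in> V i}"
      unfolding pre[OF that] by (rule openin_dominated_set)
    ultimately show ?thesis using Q unfolding quotient_map_def by simp
  qed
  have sec: "continuous_map (subtopology Q (V i)) E (\<lambda>z. the (snd z i))" if i: "i < Suc n" for i
  proof (rule continuous_compose_quotient_map)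
    show "quotient_map (subtopology ?X (?D i)) (subtopology Q (V i)) q"
      using quotient_map_restriction[OF Q pre[OF i]] V[OF i] by blast
    show "continuous_map (subtopology ?X (?D i)) E ((\<lambda>z. the (snd z i)) \<circ> q)"
      by (rule continuous_map_eq[OF e(1)]) (use i in \<open>auto simp: q_def\<close>)
  qed
  have "\<exists>i<Suc n. z \<in> V i" if zQ: "z \<in> topspace Q" for z
  proof -
    obtain y where y: "y \<in> topspace ?X" "z = q y" using zQ unfolding tQ by blast
    obtain m \<sigma> t where "y = ((m, \<sigma>), t)" by (metis surj_pair)
    then have x: "((m, \<sigma>), t) \<in> topspace ?X" "z = q ((m, \<sigma>), t)" using y by simp_all
    then have "m \<le> n" "t \<in> standard_simplex m" by (auto simp: topspace_simplex_space)
    then obtain i S where "i \<le> m" "dominates S t" "card S = Suc i"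
      using dominates_support by blast
    then have "i < Suc n" "((m, \<sigma>), t) \<in> ?D i"
      using \<open>m \<le> n\<close> x(1) by (auto simp: dominated_set_def)
    then show ?thesis using zQ x(2) by (intro exI[of _ i]) (simp add: V_def q_def)
  qed
  then have "(\<Union>i<Suc n. V i) = topspace Q" unfolding V_def by blast
  moreover have "p (the (snd z i)) = fst z" if "i < Suc n" "z \<in> V i" for i z
    using that e(2) by (auto simp: V_def tQ q_def split: if_splits)
  ultimately have "(\<Union>i<Suc n. V i) = topspace Q \<and> (\<forall>i<Suc n. openin Q (V i) \<and>
      (\<exists>s. continuous_map (subtopology Q (V i)) E s \<and> (\<forall>z\<in>V i. p (s z) = fst z)))"
    using V sec by blast
  then have "genus_le (pullback_space Q E fst p) Q fst (Suc n)"
    unfolding genus_le_pullback_iff by (rule exI[of _ V])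
  then have z: "pullback_class Q (int n) fst u = cohomology_zero Q (int n)"
    using w cQ le_weight_iff[of "Suc n" E B p "int n" u] unfolding genus_le_enat_iff by simp
  obtain c where c: "c \<in> cocycles B (int n)" "u = cohomology_class B (int n) c"
    using u unfolding cohomology_def by blast
  have "cohomology_class Q (int n) (pullback_cochain Q (int n) fst c) = cohomology_zero Q (int n)"
    using z pullback_class_cohomology_class[OF cQ] c(2) by metis
  then obtain b where b: "pullback_cochain Q (int n) fst c = coboundary Q (int n - 1) b"
    by (rule cohomology_class_eq_zeroD)
  define \<kappa> where "\<kappa> m \<sigma> = restrict (\<lambda>t. q ((m, \<sigma>), t)) (standard_simplex m)"
    for m and \<sigma> :: "(nat \<Rightarrow> real) \<Rightarrow> 'b"
  have \<kappa>: "singular_simplex m Q (\<kappa> m \<sigma>)" if "m \<le> n" "singular_simplex m B \<sigma>" for m \<sigma>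
  proof -
    let ?S = "subtopology (powertop_real UNIV) (standard_simplex m)"
    have "continuous_map ?S ?X (\<lambda>t. ((m, \<sigma>), t))"
      using that by (simp add: simplex_space_def continuous_map_in_subtopology continuous_map_paired
          continuous_map_from_subtopology)
    from continuous_map_compose[OF this quotient_imp_continuous_map[OF Q]]
    have "continuous_map ?S Q (\<kappa> m \<sigma>)"
      by (rule continuous_map_eq) (simp add: \<kappa>_def)
    then show ?thesis by (simp add: singular_simplex_def \<kappa>_def)
  qed
  have \<kappa>_face: "singular_face (Suc m) k (\<kappa> (Suc m) \<sigma>) = \<kappa> m (singular_face (Suc m) k \<sigma>)"
    if "Suc m \<le> n" "singular_simplex (Suc m) B \<sigma>" "k \<le> Suc m" for m \<sigma> k
  proof
    fix t :: "nat \<Rightarrow> real"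
    show "singular_face (Suc m) k (\<kappa> (Suc m) \<sigma>) t = \<kappa> m (singular_face (Suc m) k \<sigma>) t"
    proof (cases "t \<in> standard_simplex m")
      case True
      let ?x = "((Suc m, \<sigma>), simplical_face k t)" and ?y = "((m, singular_face (Suc m) k \<sigma>), t)"
      note face = face_in_dominated_set[OF that(2,1,3) True]
      have "e i ?x = e i ?y" if "?x \<in> ?D i" for i
        using e(3)[of ?x i ?y] face(1,2) that by blast
      then have "q ?x = q ?y"
        using face(1,3) by (auto simp: q_def fun_eq_iff)
      moreover have "simplical_face k t \<in> standard_simplex (Suc m)"
        using simplical_face_in_standard_simplex[of "Suc m" k t] that(3) True by simp
      ultimately show ?thesis using True by (simp add: \<kappa>_def singular_face_def)
    qed (simp add: \<kappa>_def singular_face_def)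
  qed
  have c\<kappa>: "c \<sigma> = coboundary Q (int n - 1) b (\<kappa> n \<sigma>)" if "singular_simplex n B \<sigma>" for \<sigma>
  proof -
    have "simplex_map n fst (\<kappa> n \<sigma>) = \<sigma>"
      using that by (auto simp: simplex_map_def \<kappa>_def q_def evaluation_def singular_simplex_def
          extensional_def fun_eq_iff)
    then have "c \<sigma> = pullback_cochain Q (int n) fst c (\<kappa> n \<sigma>)"
      using \<kappa>[OF order_refl that] by (simp add: pullback_cochain_def)
    then show ?thesis by (simp only: b)
  qed
  have "\<exists>b'\<in>cochains B (int n - 1). c = coboundary B (int n - 1) b'"
  proof (cases n)
    case 0
    \<comment> \<open>There are no cochains in degree \<open>- 1\<close>, so an exact cocycle of degree \<open>0\<close> is zero.\<close>
    have "c \<sigma> = 0" for \<sigma>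
    proof (cases "singular_simplex n B \<sigma>")
      case True
      then show ?thesis using c\<kappa> 0 by (simp add: coboundary_negative_degree)
    qed (use c(1) in \<open>auto simp: cocycles_def cochains_def\<close>)
    then have "c = coboundary B (int n - 1) 0" by (simp add: fun_eq_iff)
    then show ?thesis using zero_in_cochains by blast
  next
    case (Suc m)
    define b' where "b' \<tau> = (if singular_simplex m B \<tau> then b (\<kappa> m \<tau>) else 0)" for \<tau>
    have n: "int n - 1 = int m" "nat (int m + 1) = Suc m" by (simp_all add: Suc)
    have "c \<sigma> = coboundary B (int n - 1) b' \<sigma>" for \<sigma>
    proof (cases "singular_simplex n B \<sigma>")
      case True
      have "singular_simplex m B (singular_face (Suc m) k \<sigma>)" if "k \<le> Suc m" for k
        using singular_simplex_singular_face[of "Suc m" B \<sigma> k] that True Suc by simp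
      then show ?thesis
        using c\<kappa>[OF True] True \<kappa>[OF order_refl True] \<kappa>_face[of m \<sigma>] Suc
        by (simp add: coboundary_def n b'_def del: sum.atMost_Suc)
    next
      case False
      then have "c \<sigma> = 0" using c(1) unfolding cocycles_def cochains_def by auto
      then show ?thesis using False by (simp add: coboundary_def n Suc)
    qed
    then have "c = coboundary B (int n - 1) b'" by (simp add: fun_eq_iff)
    moreover have "b' \<in> cochains B (int n - 1)" unfolding n by (simp add: cochains_def b'_def)
    ultimately show ?thesis by blast
  qed
  then show ?thesis using cohomology_class_coboundary c(2) by blast
qed

section \<open>Cochains that vanish on part of the space\<close>

text \<open>
  For a cocycle \<open>a\<close> of degree \<open>n\<close> this means that the class of \<open>a\<close> restricts to zero on \<open>W\<close>, in the form
  that is needed: \<open>a\<close> differs by a coboundary of \<open>X\<close> from a cochain that vanishes on the simplices in \<open>W\<close>.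
\<close>

definition trivial_on :: "'a topology \<Rightarrow> 'a set \<Rightarrow> int \<Rightarrow> ('a, 'r::comm_ring_1) cochain \<Rightarrow> bool" where
  "trivial_on X W n a \<longleftrightarrow> (\<exists>x\<in>cochains X (n - 1). \<forall>\<sigma>. singular_simplex (nat n) (subtopology X W) \<sigma> \<longrightarrow>
     a \<sigma> = coboundary X (n - 1) x \<sigma>)"

lemma trivial_on_empty: "trivial_on X {} n a"
  unfolding trivial_on_def by (intro bexI[of _ 0]) (auto simp: singular_simplex_empty)

lemma trivial_on_if_class_zero:
  assumes "cohomology_class X n a = cohomology_zero X n"
  shows "trivial_on X W n a"
  using cohomology_class_eq_zeroD[OF assms] unfolding trivial_on_def by metis

text \<open>
  The sections show that the pull-back of the fibration to the union has genus at most \<open>r\<close>, so the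
  class restricts to zero there.  A cochain of the union is a cochain of \<open>B\<close> that is zero on the
  other simplices, and on simplices of the union both have the same coboundary.  The case
  \<open>r = 0\<close> is separate since only positive integers are tested in the definition of the weight.
\<close>

lemma trivial_on_union_of_sections:
  fixes E :: "'e topology" and B :: "'b topology" and U :: "nat \<Rightarrow> 'b set"
  assumes u: "u \<in> cohomology B n" and c: "c \<in> u" and w: "enat r \<le> weight E B p n u"
    and U: "\<And>i. i < r \<Longrightarrow> openin B (U i)"
      "\<And>i. i < r \<Longrightarrow> \<exists>s. continuous_map (subtopology B (U i)) E s \<and> (\<forall>x\<in>U i. p (s x) = x)"
  shows "trivial_on B (\<Union>i<r. U i) n c"
proof (cases "r = 0")
  case True
  then show ?thesis by (simp add: trivial_on_empty)
next
  case False
  let ?W = "\<Union>i<r. U i"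
  let ?A = "subtopology B ?W"
  have "?W \<subseteq> topspace B" using U(1) openin_subset by blast
  then have cover: "(\<Union>i<r. U i) = topspace ?A" by auto
  have "openin ?A (U i) \<and> (\<exists>s. continuous_map (subtopology ?A (U i)) E s \<and> (\<forall>x\<in>U i. p (s x) = x))"
    if i: "i < r" for i
  proof
    have int: "?W \<inter> U i = U i" using i by blast
    show "openin ?A (U i)"
      using openin_subtopology_Int2[OF U(1)[OF i], of ?W] unfolding int .
    show "\<exists>s. continuous_map (subtopology ?A (U i)) E s \<and> (\<forall>x\<in>U i. p (s x) = x)"
      unfolding subtopology_subtopology int by (rule U(2)[OF i])
  qed
  then have "genus_le (pullback_space ?A E (\<lambda>x. x) p) ?A fst r"
    unfolding genus_le_pullback_iff using cover by blast
  moreover have f: "continuous_map ?A B (\<lambda>x. x)"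
    by (simp add: continuous_map_from_subtopology)
  ultimately have "pullback_class ?A n (\<lambda>x. x) u = cohomology_zero ?A n"
    using False le_weightD[OF _ w u f] by (simp add: genus_le_enat_iff)
  then have "cohomology_class ?A n (pullback_cochain ?A n (\<lambda>x. x) c) = cohomology_zero ?A n"
    using pullback_class_cohomology_class[OF f] cohomology_representative(2)[OF u c] by metis
  then obtain b where b: "b \<in> cochains ?A (n - 1)"
    "pullback_cochain ?A n (\<lambda>x. x) c = coboundary ?A (n - 1) b"
    by (rule cohomology_class_eq_zeroD)
  have "c \<sigma> = coboundary B (n - 1) b \<sigma>" if \<sigma>: "singular_simplex (nat n) ?A \<sigma>" for \<sigma>
  proof -
    have "simplex_map (nat n) (\<lambda>x. x) \<sigma> = \<sigma>" by (rule simplex_map_id_gen[OF \<sigma>]) simp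
    then have "c \<sigma> = coboundary ?A (n - 1) b \<sigma>"
      using fun_cong[OF b(2), of \<sigma>] \<sigma> by (simp add: pullback_cochain_def)
    also have "\<dots> = coboundary B (n - 1) b \<sigma>"
      using \<sigma> by (simp add: coboundary_def singular_simplex_subtopology)
    finally show ?thesis .
  qed
  moreover have "b \<in> cochains B (n - 1)"
    using b(1) unfolding cochains_def by (auto simp: singular_simplex_subtopology)
  ultimately show ?thesis unfolding trivial_on_def by blast
qed

lemma trivial_on_cocycle:
  assumes a: "a \<in> cocycles X n" and W: "trivial_on X W n a"
  obtains a' x where "a' \<in> cocycles X n" "x \<in> cochains X (n - 1)" "a = a' + coboundary X (n - 1) x"
    "\<And>\<sigma>. singular_simplex (nat n) (subtopology X W) \<sigma> \<Longrightarrow> a' \<sigma> = 0"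
proof -
  obtain x where x: "x \<in> cochains X (n - 1)"
    "\<And>\<sigma>. singular_simplex (nat n) (subtopology X W) \<sigma> \<Longrightarrow> a \<sigma> = coboundary X (n - 1) x \<sigma>"
    using W unfolding trivial_on_def by blast
  have "coboundary X (n - 1) x \<in> cochains X n"
    using coboundary_in_cochains[of X "n - 1" x] by simp
  moreover have "coboundary X n (coboundary X (n - 1) x) = 0"
    using coboundary_coboundary[of X "n - 1" x] by simp
  ultimately have "a - coboundary X (n - 1) x \<in> cocycles X n"
    using a unfolding cocycles_def by (auto simp: coboundary_minus diff_in_cochains fun_eq_iff)
  then show ?thesis
    using that[of "a - coboundary X (n - 1) x" x] x by simp
qed

lemma cup_vanishes_if_left:
  assumes "singular_simplex (nat (m + n)) (subtopology X V) \<sigma>"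
    "\<And>\<tau>. singular_simplex (nat m) (subtopology X V) \<tau> \<Longrightarrow> a \<tau> = 0"
  shows "cup X m n a b \<sigma> = 0"
  using assms singular_simplex_front_face[of "nat m" "nat n" "subtopology X V" \<sigma>]
  by (auto simp: cup_def nat_add_distrib)

lemma cup_vanishes_if_right:
  assumes "singular_simplex (nat (m + n)) (subtopology X V) \<sigma>"
    "\<And>\<tau>. singular_simplex (nat n) (subtopology X V) \<tau> \<Longrightarrow> b \<tau> = 0"
  shows "cup X m n a b \<sigma> = 0"
  using assms singular_simplex_back_face[of "nat m" "nat n" "subtopology X V" \<sigma>]
  by (auto simp: cup_def nat_add_distrib)

section \<open>The inequality between genus and weights\<close>

text \<open>
  The corrected cocycles \<open>a'\<close> and \<open>c'\<close> vanish on \<open>Y\<close>, and \<open>b'\<close> vanishes on \<open>X\<close>.  Each of the products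
  \<open>a' \<bullet> b'\<close> and \<open>b' \<bullet> c'\<close> has a factor of either kind, so it vanishes on simplices in \<open>X\<close> and on simplices in \<open>Y\<close>,
  and the principle for small cocycles applies to both and then to the third product.
\<close>

lemma massey_vanishes_if_trivial_on_cover:
  assumes op: "openin B X" "openin B Y" and cov: "topspace B \<subseteq> X \<union> Y"
    and a: "a \<in> cocycles B (int i)" and b: "b \<in> cocycles B (int j)" and c: "c \<in> cocycles B (int k)"
    and aY: "trivial_on B Y (int i) a" and bX: "trivial_on B X (int j) b" and cY: "trivial_on B Y (int k) c"
  shows "massey_vanishes B i j k a b c"
proof -
  obtain a' x where a': "a' \<in> cocycles B (int i)" "x \<in> cochains B (int i - 1)"
    "a = a' + coboundary B (int i - 1) x"
    "\<And>\<sigma>. singular_simplex (nat (int i)) (subtopology B Y) \<sigma> \<Longrightarrow> a' \<sigma> = 0"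
    by (rule trivial_on_cocycle[OF a aY]) blast
  obtain b' y where b': "b' \<in> cocycles B (int j)" "y \<in> cochains B (int j - 1)"
    "b = b' + coboundary B (int j - 1) y"
    "\<And>\<sigma>. singular_simplex (nat (int j)) (subtopology B X) \<sigma> \<Longrightarrow> b' \<sigma> = 0"
    by (rule trivial_on_cocycle[OF b bX]) blast
  obtain c' z where c': "c' \<in> cocycles B (int k)" "z \<in> cochains B (int k - 1)"
    "c = c' + coboundary B (int k - 1) z"
    "\<And>\<sigma>. singular_simplex (nat (int k)) (subtopology B Y) \<sigma> \<Longrightarrow> c' \<sigma> = 0"
    by (rule trivial_on_cocycle[OF c cY]) blast
  have d0: "coboundary B (int i) a' = 0" "coboundary B (int j) b' = 0" "coboundary B (int k) c' = 0"
    "coboundary B (int i) a = 0" "coboundary B (int j) b = 0" "coboundary B (int k) c = 0"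
    using a'(1) b'(1) c'(1) a b c unfolding cocycles_def zero_fun_def by blast+
  let ?C = "{X, Y}"
  have C: "\<And>V. V \<in> ?C \<Longrightarrow> openin B V" "topspace B \<subseteq> \<Union>?C" using op cov by auto
  have cocycleI: "f \<in> cocycles B n" if "f \<in> cochains B n" "coboundary B n f = 0" for f :: "('a, 'b) cochain" and n
    using that unfolding cocycles_def zero_fun_def by blast
  have ab: "cup B i j a' b' \<in> cocycles B (int i + int j)"
    using coboundary_cup[of B "int i" "int j" a' b'] d0 by (intro cocycleI cup_in_cochains) simp
  have bc: "cup B j k b' c' \<in> cocycles B (int j + int k)"
    using coboundary_cup[of B "int j" "int k" b' c'] d0 by (intro cocycleI cup_in_cochains) simp
  have "cup B i j a' b' \<sigma> = 0" if "small_simplex ?C B (nat (int i + int j)) \<sigma>" for \<sigma>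
  proof -
    consider "singular_simplex (nat (int i + int j)) (subtopology B X) \<sigma>"
      | "singular_simplex (nat (int i + int j)) (subtopology B Y) \<sigma>"
      using \<open>small_simplex _ _ _ _\<close> unfolding small_simplex_def by blast
    then show ?thesis
    proof cases
      case 1
      then show ?thesis by (rule cup_vanishes_if_right) (rule b'(4))
    next
      case 2
      then show ?thesis by (rule cup_vanishes_if_left) (rule a'(4))
    qed
  qed
  then obtain m where m: "m \<in> cochains B (int i + int j - 1)"
    "coboundary B (int i + int j - 1) m = cup B i j a' b'"
    "\<And>\<sigma>. small_simplex ?C B (nat (int i + int j - 1)) \<sigma> \<Longrightarrow> m \<sigma> = 0"
    using small_cocycle_is_small_coboundary[OF C ab] by metis
  have "cup B j k b' c' \<sigma> = 0" if "small_simplex ?C B (nat (int j + int k)) \<sigma>" for \<sigma>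
  proof -
    consider "singular_simplex (nat (int j + int k)) (subtopology B X) \<sigma>"
      | "singular_simplex (nat (int j + int k)) (subtopology B Y) \<sigma>"
      using \<open>small_simplex _ _ _ _\<close> unfolding small_simplex_def by blast
    then show ?thesis
    proof cases
      case 1
      then show ?thesis by (rule cup_vanishes_if_left) (rule b'(4))
    next
      case 2
      then show ?thesis by (rule cup_vanishes_if_right) (rule c'(4))
    qed
  qed
  then obtain l where l: "l \<in> cochains B (int j + int k - 1)"
    "coboundary B (int j + int k - 1) l = cup B j k b' c'"
    "\<And>\<sigma>. small_simplex ?C B (nat (int j + int k - 1)) \<sigma> \<Longrightarrow> l \<sigma> = 0"
    using small_cocycle_is_small_coboundary[OF C bc] by metis
  let ?n = "int i + int j + int k - 1"
  have e: "int i + (int j + int k - 1) = ?n" "int i + int j - 1 + int k = ?n" "?n - 1 = int i + int j + int k - 2"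
    by simp_all
  let ?w = "cup B i (int j + int k - 1) a' l + (- 1) ^ (i + 1) * cup B (int i + int j - 1) k m c'"
  have "coboundary B ?n (cup B i (int j + int k - 1) a' l) = (- 1) ^ i * cup B i (int j + int k) a' (cup B j k b' c')"
    using coboundary_cup[of B "int i" "int j + int k - 1" a' l] d0 l(2) unfolding e by simp
  moreover have "coboundary B ?n (cup B (int i + int j - 1) k m c') = cup B (int i + int j) k (cup B i j a' b') c'"
    using coboundary_cup[of B "int i + int j - 1" "int k" m c'] d0 m(2) unfolding e by simp
  ultimately have "coboundary B ?n ?w = 0"
    using cup_assoc[of B "int i" "int j" "int k" a' b' c']
    by (simp add: coboundary_plus coboundary_minus coboundary_sign)
  moreover have "?w \<in> cochains B ?n"
    using cup_in_cochains[of B "int i" "int j + int k - 1" a' l] cup_in_cochains[of B "int i + int j - 1" "int k" m c']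
    unfolding e by (intro plus_in_cochains times_in_cochains)
  ultimately have w: "?w \<in> cocycles B ?n" by (intro cocycleI)
  have "?w \<sigma> = 0" if \<sigma>: "small_simplex ?C B (nat ?n) \<sigma>" for \<sigma>
  proof -
    obtain V where V: "V \<in> ?C" "singular_simplex (nat ?n) (subtopology B V) \<sigma>"
      using \<sigma> unfolding small_simplex_def by blast
    have "small_simplex ?C B q \<tau>" if "singular_simplex q (subtopology B V) \<tau>" for q \<tau>
      using V(1) that unfolding small_simplex_def by blast
    note small = l(3)[OF this] m(3)[OF this]
    have "cup B i (int j + int k - 1) a' l \<sigma> = 0"
      by (rule cup_vanishes_if_right[OF _ small(1)]) (unfold e, rule V(2))
    moreover have "cup B (int i + int j - 1) k m c' \<sigma> = 0"
      by (rule cup_vanishes_if_left[OF _ small(2)]) (unfold e, rule V(2))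
    ultimately show ?thesis by simp
  qed
  then obtain v where v: "v \<in> cochains B (?n - 1)" "coboundary B (?n - 1) v = ?w"
    using small_cocycle_is_small_coboundary[OF C w] by metis
  have "massey_vanishes B i j k a' b' c'"
    unfolding massey_vanishes_def using m(1,2) l(1,2) v unfolding e(3)
    by (intro exI[of _ m] exI[of _ l] exI[of _ v]) simp
  then have "massey_vanishes B i j k a b' c'"
    unfolding a'(3) by (rule massey_vanishes_change_left[OF _ a'(2) d0(2)])
  then have "massey_vanishes B i j k a b' c"
    unfolding c'(3) by (rule massey_vanishes_change_right[OF _ c'(2) d0(2)])
  then show ?thesis
    unfolding b'(3) by (rule massey_vanishes_change_middle[OF _ b'(2) d0(4,6)])
qed

lemma enat_le_add_split:
  assumes "enat g \<le> x + y"
  obtains r s where "g = r + s" "enat r \<le> x" "enat s \<le> y"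
proof (cases "enat g \<le> x")
  case True
  then show ?thesis using that[of g 0] by (simp add: zero_enat_def[symmetric])
next
  case False
  then obtain r where r: "x = enat r" "r < g" by (cases x) auto
  have "enat (g - r) \<le> y" using assms r by (cases y) auto
  then show ?thesis using that[of r "g - r"] r by simp
qed

lemma weight_infinite_imp_zero:
  assumes "fibration E B p" "path_connected_space B" "topspace E \<noteq> {}"
    "u \<in> cohomology B (int n)" "weight E B p (int n) u = \<infinity>"
  shows "u = cohomology_zero B (int n)"
  by (rule weight_gt_degree_imp_zero[OF assms(1-4)]) (simp add: assms(5))

theorem theorem3p1:
  fixes E :: "'e topology" and B :: "'b topology" and p :: "'e \<Rightarrow> 'b"
    and i j k :: nat and \<alpha> \<beta> \<gamma> :: "('b, 'r::comm_ring_1) cochain set"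
  assumes "path_connected_space E" "topspace E \<noteq> {}" "finite_type E"
    and "path_connected_space B" "topspace B \<noteq> {}" "finite_type B"
    and "fibration E B p"
    and "\<alpha> \<in> cohomology B i" "\<beta> \<in> cohomology B j" "\<gamma> \<in> cohomology B k"
    and "massey_defined B i j k \<alpha> \<beta> \<gamma>"
    and "massey_nonzero B i j k \<alpha> \<beta> \<gamma>"
  shows "genus E B p > weight E B p j \<beta> + min (weight E B p i \<alpha>) (weight E B p k \<gamma>)"
proof (rule ccontr)
  let ?wb = "weight E B p j \<beta>" and ?wm = "min (weight E B p i \<alpha>) (weight E B p k \<gamma>)"
  assume "\<not> genus E B p > ?wb + ?wm"
  then have le: "genus E B p \<le> ?wb + ?wm" by simp
  define a where "a = (SOME a. a \<in> \<alpha>)"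
  define b where "b = (SOME b. b \<in> \<beta>)"
  define c where "c = (SOME c. c \<in> \<gamma>)"
  have in_class: "a \<in> \<alpha>" "b \<in> \<beta>" "c \<in> \<gamma>"
    using assms(8-10) cohomology_nonempty unfolding a_def b_def c_def by blast+
  note rep = cohomology_representative[OF assms(8) in_class(1)]
    cohomology_representative[OF assms(9) in_class(2)] cohomology_representative[OF assms(10) in_class(3)]
  note zero = weight_infinite_imp_zero[OF assms(7,4,2)]
  have "\<exists>X Y. openin B X \<and> openin B Y \<and> topspace B \<subseteq> X \<union> Y \<and>
      trivial_on B Y i a \<and> trivial_on B X j b \<and> trivial_on B Y k c"
  proof (cases "genus E B p")
    case (enat g)
    then obtain r s where rs: "g = r + s" "enat r \<le> ?wb" "enat s \<le> ?wm"
      using le enat_le_add_split by metis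
    have "genus_le E B p g" using enat genus_le_enat_iff[of E B p g] by simp
    then obtain U where U: "(\<Union>i<g. U i) = topspace B"
      "\<forall>i<g. openin B (U i) \<and> (\<exists>s. continuous_map (subtopology B (U i)) E s \<and> (\<forall>x\<in>U i. p (s x) = x))"
      unfolding genus_le_def by blast
    \<comment> \<open>The weight of \<open>\<beta>\<close> is spent on the first \<open>r\<close> sets, those of \<open>\<alpha>\<close> and \<open>\<gamma>\<close> on the remaining \<open>s\<close>.\<close>
    let ?X = "\<Union>i<r. U i" and ?Y = "\<Union>i<s. U (r + i)"
    have "openin B ?X" "openin B ?Y" using U(2) rs(1) by auto
    moreover have "topspace B \<subseteq> ?X \<union> ?Y"
    proof
      fix x assume "x \<in> topspace B"
      then obtain i where i: "i < g" "x \<in> U i" using U(1) by blast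
      show "x \<in> ?X \<union> ?Y"
      proof (cases "i < r")
        case False
        then have "i - r < s" "x \<in> U (r + (i - r))" using i rs(1) by auto
        then show ?thesis by blast
      qed (use i in blast)
    qed
    moreover have "trivial_on B ?X j b"
      by (rule trivial_on_union_of_sections[OF assms(9) in_class(2) rs(2)]) (use U(2) rs(1) in simp_all)
    moreover have "trivial_on B ?Y i a" "trivial_on B ?Y k c"
      by (rule trivial_on_union_of_sections[OF assms(8) in_class(1), of s E p "\<lambda>i. U (r + i)"];
          use U(2) rs(1,3) in simp)
         (rule trivial_on_union_of_sections[OF assms(10) in_class(3), of s E p "\<lambda>i. U (r + i)"];
          use U(2) rs(1,3) in simp)
    ultimately show ?thesis by blast
  next
    case infinity
    then have "?wb = \<infinity> \<or> ?wm = \<infinity>" using le by (metis enat_ord_simps(5) plus_eq_infty_iff_enat)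
    then show ?thesis
    proof
      assume "?wb = \<infinity>"
      then have "trivial_on B (topspace B) j b"
        using zero[OF assms(9)] rep(4) by (intro trivial_on_if_class_zero) simp
      then show ?thesis
        by (intro exI[of _ "topspace B"] exI[of _ "{}"]) (simp add: trivial_on_empty)
    next
      assume "?wm = \<infinity>"
      then have "weight E B p i \<alpha> = \<infinity>" "weight E B p k \<gamma> = \<infinity>"
        by (auto simp: min_def split: if_splits)
      then have "trivial_on B (topspace B) i a" "trivial_on B (topspace B) k c"
        using zero[OF assms(8)] zero[OF assms(10)] rep(2,6) by (simp_all add: trivial_on_if_class_zero)
      then show ?thesis
        by (intro exI[of _ "{}"] exI[of _ "topspace B"]) (simp add: trivial_on_empty)
    qed
  qed
  then have "massey_vanishes B i j k a b c"
    using massey_vanishes_if_trivial_on_cover rep(1,3,5) by metis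
  then show False
    using massey_vanishes_imp_zero_in_massey_cocycles assms(12)
    unfolding massey_nonzero_def massey_product_def a_def b_def c_def by metis
qed

end
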